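(* Over $\mathbf{IA_1}$ (and likewise over $\mathbf{HA_1}$), the schemata $\mathrm{QF\text{-}AC_{00}}$ and $\mathrm{CF_d}$ together entail $\mathrm{AC_{00}!}$; that is, every instance of $\mathrm{AC_{00}!}$ is provable in $\mathbf{IA_1}+\mathrm{QF\text{-}AC_{00}}+\mathrm{CF_d}$ (resp. in $\mathbf{HA_1}+\mathrm{QF\text{-}AC_{00}}+\mathrm{CF_d}$).
   Context: All systems are based on two-sorted intuitionistic predicate logic with number variables $x,y,z,\dots$ (intended to range over natural numbers) and function variables $\alpha,\beta,\gamma,\dots$ (intended to range over one-place number-theoretic functions). Number equality $=$ is primitive; equality of functors is the abbreviation $u=v :\equiv \forall x\, u(x)=v(x)$. Terms denote numbers, functors denote unary functions, $u(t)$ is function application, $x'$ (or $S(x)$) is successor. $\exists! y\,B(y)$ abbreviates $\exists y[B(y)\,\&\,\forall z(B(z)\to y=z)]$. $\langle x_0,\dots,x_k\rangle=p_0^{x_0}\cdots p_k^{x_k}$ where $p_i$ is the $i$-th prime, and $(w)_i$ denotes the exponent of $p_i$ in $w$. $\mathbf{IA_1}$: language with constants $0,',+,\cdot$ and finitely many further primitive recursive function(al) constants (exponentiation, factorial, predecessor, cut-off subtraction $\dot-$, min, max, $\mathrm{sg}$, $\overline{\mathrm{sg}}$, $|a-b|$, remainder, quotient, the functionals $\Sigma_{y<z}\alpha(y)$, $\Pi_{y<z}\alpha(y)$, $\min_{y\le z}\alpha(y)$, $\max_{y\le z}\alpha(y)$, the prime enumeration $p_i$, the exponent $(a)_i$,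 length $\mathrm{lh}(a)$, concatenation $a*b$, $\overline{\alpha}(x)=\Pi_{i<x}p_i^{\alpha(i)+1}$, $\widetilde{\alpha}(x)=\Pi_{i<x}p_i^{\alpha(i)}$, $a\circ b=\Pi_{i<\max(a,b)}p_i^{\max((a)_i,(b)_i)}$, and Kleene's primitive recursive computation-tree function $\mathrm{ccp}$), function application and $\lambda$-abstraction ($\lambda x.t$ is a functor for any term $t$). Axioms: $\neg a'=0$, $a'=b'\to a=b$, $a=b\to a'=b'$, equality axioms for $=$, recursion equations for $+,\cdot$ and the defining (explicit or primitive recursive) equations of the other constants, $x=y\to\alpha(x)=\alpha(y)$, $\lambda$-conversion $(\lambda x.t(x))(s)=t(s)$ ($s$ free for $x$), and the induction schema $A(0)\,\&\,\forall x(A(x)\to A(x'))\to A(x)$ for all formulas. $\mathbf{HA_1}$: language with $0$, a function constant for every primitive recursive description (including $S$), application, $\lambda$-abstraction, and a recursor constant $\mathrm{rec}$ (if $t,s$ are terms and $u$ a functor then $\mathrm{rec}(t,u,s)$ is a term). Axioms: $x=x$, replacement $A(x)\,\&\,x=y\to A(y)$, induction for all formulas, $\neg S(0)=0$, the defining equations of the primitive recursive function constants, $\lambda$-conversion, and $\mathrm{rec}(t,u,0)=t$, $\mathrm{rec}(t,u,S(s))=u(\langle \mathrm{rec}(t,u,s),s\rangle)$. Schemata: $\mathrm{AC_{00}!}$: $\forall x\exists! y\,A(x,y)\to\exists\alpha\forall x\,A(x,\alpha(x))$ ($\alpha$ not free in $A$). $\mathrm{QF\text{-}AC_{00}}$: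 $\forall x\exists y\,A(x,y)\to\exists\alpha\forall x\,A(x,\alpha(x))$ for quantifier-free $A$ not containing $\alpha$. $\mathrm{CF_d}$: $\forall x(B(x)\vee\neg B(x))\to\exists\beta\forall x[\beta(x)\le 1\,\&\,(\beta(x)=0\leftrightarrow B(x))]$ ($\beta$ not free in $B$). *)

theory Defs
  imports Main
begin

section \<open>Two-sorted syntax\<close>

text \<open>
  Variables are de Bruijn indices, counted separately for the two sorts.  Hence
  alpha-congruent expressions are identified, substitution is capture-avoiding, and provisos
  such as "free for" or "not free in" become index shifts.

  A constant of arity \<open>(k, l)\<close> takes \<open>k\<close> number arguments and \<open>l\<close> function arguments.
  Constants of arity \<open>(1, 0)\<close> are themselves functors (\<open>FCon\<close>) and are applied by \<open>App\<close>;
  \<open>Con\<close> is used for the constants of all other arities, so that \<open>f(t)\<close> has one representation.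
\<close>

datatype 'c trm =
    NVar nat
  | App "'c fnc" "'c trm"
  | Con 'c "'c trm list" "'c fnc list"
and 'c fnc =
    FVar nat
  | FCon 'c
  | Lam "'c trm"

datatype 'c fm =
    Eq "'c trm" "'c trm"      (infix "\<doteq>" 55)
  | Neg "'c fm"               ("\<^bold>\<not> _" [54] 54)
  | And "'c fm" "'c fm"       (infixr "\<^bold>\<and>" 53)
  | Or "'c fm" "'c fm"        (infixr "\<^bold>\<or>" 52)
  | Imp "'c fm" "'c fm"       (infixr "\<^bold>\<longrightarrow>" 51)
  | AllN "'c fm"
  | ExN "'c fm"
  | AllF "'c fm"
  | ExF "'c fm"

text \<open>\<open>arity L c = None\<close> means that \<open>c\<close> is not a constant of the language \<open>L\<close>.\<close>

record 'c lang =
  arity :: "'c \<Rightarrow> (nat \<times> nat) option"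
  zeroC :: 'c
  sucC :: 'c
  plusC :: 'c

fun wf_trm :: "'c lang \<Rightarrow> 'c trm \<Rightarrow> bool" and wf_fnc :: "'c lang \<Rightarrow> 'c fnc \<Rightarrow> bool" where
  "wf_trm L (NVar n) \<longleftrightarrow> True"
| "wf_trm L (App u t) \<longleftrightarrow> wf_fnc L u \<and> wf_trm L t"
| "wf_trm L (Con c ts us) \<longleftrightarrow>
     arity L c = Some (length ts, length us) \<and> (length ts, length us) \<noteq> (1, 0) \<and>
     (\<forall>t \<in> set ts. wf_trm L t) \<and> (\<forall>u \<in> set us. wf_fnc L u)"
| "wf_fnc L (FVar n) \<longleftrightarrow> True"
| "wf_fnc L (FCon c) \<longleftrightarrow> arity L c = Some (1, 0)"
| "wf_fnc L (Lam t) \<longleftrightarrow> wf_trm L t"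

primrec wf_fm :: "'c lang \<Rightarrow> 'c fm \<Rightarrow> bool" where
  "wf_fm L (s \<doteq> t) \<longleftrightarrow> wf_trm L s \<and> wf_trm L t"
| "wf_fm L (\<^bold>\<not> A) \<longleftrightarrow> wf_fm L A"
| "wf_fm L (A \<^bold>\<and> B) \<longleftrightarrow> wf_fm L A \<and> wf_fm L B"
| "wf_fm L (A \<^bold>\<or> B) \<longleftrightarrow> wf_fm L A \<and> wf_fm L B"
| "wf_fm L (A \<^bold>\<longrightarrow> B) \<longleftrightarrow> wf_fm L A \<and> wf_fm L B"
| "wf_fm L (AllN A) \<longleftrightarrow> wf_fm L A"
| "wf_fm L (ExN A) \<longleftrightarrow> wf_fm L A"
| "wf_fm L (AllF A) \<longleftrightarrow> wf_fm L A"
| "wf_fm L (ExF A) \<longleftrightarrow> wf_fm L A"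

primrec quantifier_free :: "'c fm \<Rightarrow> bool" where
  "quantifier_free (s \<doteq> t) \<longleftrightarrow> True"
| "quantifier_free (\<^bold>\<not> A) \<longleftrightarrow> quantifier_free A"
| "quantifier_free (A \<^bold>\<and> B) \<longleftrightarrow> quantifier_free A \<and> quantifier_free B"
| "quantifier_free (A \<^bold>\<or> B) \<longleftrightarrow> quantifier_free A \<and> quantifier_free B"
| "quantifier_free (A \<^bold>\<longrightarrow> B) \<longleftrightarrow> quantifier_free A \<and> quantifier_free B"
| "quantifier_free (AllN A) \<longleftrightarrow> False"
| "quantifier_free (ExN A) \<longleftrightarrow> False"
| "quantifier_free (AllF A) \<longleftrightarrow> False"
| "quantifier_free (ExF A) \<longleftrightarrow> False"

section \<open>Renaming and substitution\<close>

text \<open>First map: number variables; second map: function variables.\<close>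

definition up :: "(nat \<Rightarrow> nat) \<Rightarrow> nat \<Rightarrow> nat" where
  "up r = case_nat 0 (\<lambda>n. Suc (r n))"

primrec ren_trm :: "(nat \<Rightarrow> nat) \<Rightarrow> (nat \<Rightarrow> nat) \<Rightarrow> 'c trm \<Rightarrow> 'c trm"
  and ren_fnc :: "(nat \<Rightarrow> nat) \<Rightarrow> (nat \<Rightarrow> nat) \<Rightarrow> 'c fnc \<Rightarrow> 'c fnc" where
  "ren_trm r q (NVar n) = NVar (r n)"
| "ren_trm r q (App u t) = App (ren_fnc r q u) (ren_trm r q t)"
| "ren_trm r q (Con c ts us) = Con c (map (ren_trm r q) ts) (map (ren_fnc r q) us)"
| "ren_fnc r q (FVar n) = FVar (q n)"
| "ren_fnc r q (FCon c) = FCon c"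
| "ren_fnc r q (Lam t) = Lam (ren_trm (up r) q t)"

primrec ren_fm :: "(nat \<Rightarrow> nat) \<Rightarrow> (nat \<Rightarrow> nat) \<Rightarrow> 'c fm \<Rightarrow> 'c fm" where
  "ren_fm r q (s \<doteq> t) = (ren_trm r q s \<doteq> ren_trm r q t)"
| "ren_fm r q (\<^bold>\<not> A) = \<^bold>\<not> ren_fm r q A"
| "ren_fm r q (A \<^bold>\<and> B) = (ren_fm r q A \<^bold>\<and> ren_fm r q B)"
| "ren_fm r q (A \<^bold>\<or> B) = (ren_fm r q A \<^bold>\<or> ren_fm r q B)"
| "ren_fm r q (A \<^bold>\<longrightarrow> B) = (ren_fm r q A \<^bold>\<longrightarrow> ren_fm r q B)"
| "ren_fm r q (AllN A) = AllN (ren_fm (up r) q A)"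
| "ren_fm r q (ExN A) = ExN (ren_fm (up r) q A)"
| "ren_fm r q (AllF A) = AllF (ren_fm r (up q) A)"
| "ren_fm r q (ExF A) = ExF (ren_fm r (up q) A)"

text \<open>Passage of a simultaneous substitution under a number binder and a function binder.\<close>

definition upN_trm :: "(nat \<Rightarrow> 'c trm) \<Rightarrow> nat \<Rightarrow> 'c trm" where
  "upN_trm \<sigma> = case_nat (NVar 0) (\<lambda>n. ren_trm Suc id (\<sigma> n))"

definition upN_fnc :: "(nat \<Rightarrow> 'c fnc) \<Rightarrow> nat \<Rightarrow> 'c fnc" where
  "upN_fnc \<tau> = (\<lambda>n. ren_fnc Suc id (\<tau> n))"

definition upF_trm :: "(nat \<Rightarrow> 'c trm) \<Rightarrow> nat \<Rightarrow> 'c trm" where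
  "upF_trm \<sigma> = (\<lambda>n. ren_trm id Suc (\<sigma> n))"

definition upF_fnc :: "(nat \<Rightarrow> 'c fnc) \<Rightarrow> nat \<Rightarrow> 'c fnc" where
  "upF_fnc \<tau> = case_nat (FVar 0) (\<lambda>n. ren_fnc id Suc (\<tau> n))"

primrec sub_trm :: "(nat \<Rightarrow> 'c trm) \<Rightarrow> (nat \<Rightarrow> 'c fnc) \<Rightarrow> 'c trm \<Rightarrow> 'c trm"
  and sub_fnc :: "(nat \<Rightarrow> 'c trm) \<Rightarrow> (nat \<Rightarrow> 'c fnc) \<Rightarrow> 'c fnc \<Rightarrow> 'c fnc" where
  "sub_trm \<sigma> \<tau> (NVar n) = \<sigma> n"
| "sub_trm \<sigma> \<tau> (App u t) = App (sub_fnc \<sigma> \<tau> u) (sub_trm \<sigma> \<tau> t)"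
| "sub_trm \<sigma> \<tau> (Con c ts us) = Con c (map (sub_trm \<sigma> \<tau>) ts) (map (sub_fnc \<sigma> \<tau>) us)"
| "sub_fnc \<sigma> \<tau> (FVar n) = \<tau> n"
| "sub_fnc \<sigma> \<tau> (FCon c) = FCon c"
| "sub_fnc \<sigma> \<tau> (Lam t) = Lam (sub_trm (upN_trm \<sigma>) (upN_fnc \<tau>) t)"

primrec sub_fm :: "(nat \<Rightarrow> 'c trm) \<Rightarrow> (nat \<Rightarrow> 'c fnc) \<Rightarrow> 'c fm \<Rightarrow> 'c fm" where
  "sub_fm \<sigma> \<tau> (s \<doteq> t) = (sub_trm \<sigma> \<tau> s \<doteq> sub_trm \<sigma> \<tau> t)"
| "sub_fm \<sigma> \<tau> (\<^bold>\<not> A) = \<^bold>\<not> sub_fm \<sigma> \<tau> A"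
| "sub_fm \<sigma> \<tau> (A \<^bold>\<and> B) = (sub_fm \<sigma> \<tau> A \<^bold>\<and> sub_fm \<sigma> \<tau> B)"
| "sub_fm \<sigma> \<tau> (A \<^bold>\<or> B) = (sub_fm \<sigma> \<tau> A \<^bold>\<or> sub_fm \<sigma> \<tau> B)"
| "sub_fm \<sigma> \<tau> (A \<^bold>\<longrightarrow> B) = (sub_fm \<sigma> \<tau> A \<^bold>\<longrightarrow> sub_fm \<sigma> \<tau> B)"
| "sub_fm \<sigma> \<tau> (AllN A) = AllN (sub_fm (upN_trm \<sigma>) (upN_fnc \<tau>) A)"
| "sub_fm \<sigma> \<tau> (ExN A) = ExN (sub_fm (upN_trm \<sigma>) (upN_fnc \<tau>) A)"
| "sub_fm \<sigma> \<tau> (AllF A) = AllF (sub_fm (upF_trm \<sigma>) (upF_fnc \<tau>) A)"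
| "sub_fm \<sigma> \<tau> (ExF A) = ExF (sub_fm (upF_trm \<sigma>) (upF_fnc \<tau>) A)"

text \<open>Instantiation of the variable with index \<open>0\<close>, whose binder is removed.\<close>

definition instT :: "'c trm \<Rightarrow> 'c trm \<Rightarrow> 'c trm" where
  "instT t s = sub_trm (case_nat s NVar) FVar t"

definition instN :: "'c fm \<Rightarrow> 'c trm \<Rightarrow> 'c fm" where
  "instN A s = sub_fm (case_nat s NVar) FVar A"

definition instF :: "'c fm \<Rightarrow> 'c fnc \<Rightarrow> 'c fm" where
  "instF A u = sub_fm NVar (case_nat u FVar) A"

abbreviation liftN :: "'c fm \<Rightarrow> 'c fm" where "liftN \<equiv> ren_fm Suc id"
abbreviation liftF :: "'c fm \<Rightarrow> 'c fm" where "liftF \<equiv> ren_fm id Suc"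

section \<open>Intuitionistic two-sorted predicate logic\<close>

text \<open>
  Natural deduction from a set \<open>T\<close> of axioms under a list \<open>\<Gamma>\<close> of assumptions.  Free variables
  of axioms are read universally: the generalization rules shift \<open>\<Gamma>\<close>, but not \<open>T\<close>.
\<close>

inductive ded :: "'c lang \<Rightarrow> 'c fm set \<Rightarrow> 'c fm list \<Rightarrow> 'c fm \<Rightarrow> bool"
  for L :: "'c lang" and T :: "'c fm set" where
  Axiom: "A \<in> T \<Longrightarrow> ded L T \<Gamma> A"
| Assm: "A \<in> set \<Gamma> \<Longrightarrow> ded L T \<Gamma> A"
| ImpI: "wf_fm L A \<Longrightarrow> ded L T (A # \<Gamma>) B \<Longrightarrow> ded L T \<Gamma> (A \<^bold>\<longrightarrow> B)"
| ImpE: "ded L T \<Gamma> (A \<^bold>\<longrightarrow> B) \<Longrightarrow> ded L T \<Gamma> A \<Longrightarrow> ded L T \<Gamma> B"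
| AndI: "ded L T \<Gamma> A \<Longrightarrow> ded L T \<Gamma> B \<Longrightarrow> ded L T \<Gamma> (A \<^bold>\<and> B)"
| AndE1: "ded L T \<Gamma> (A \<^bold>\<and> B) \<Longrightarrow> ded L T \<Gamma> A"
| AndE2: "ded L T \<Gamma> (A \<^bold>\<and> B) \<Longrightarrow> ded L T \<Gamma> B"
| OrI1: "ded L T \<Gamma> A \<Longrightarrow> wf_fm L B \<Longrightarrow> ded L T \<Gamma> (A \<^bold>\<or> B)"
| OrI2: "wf_fm L A \<Longrightarrow> ded L T \<Gamma> B \<Longrightarrow> ded L T \<Gamma> (A \<^bold>\<or> B)"
| OrE: "ded L T \<Gamma> (A \<^bold>\<or> B) \<Longrightarrow> ded L T (A # \<Gamma>) C \<Longrightarrow> ded L T (B # \<Gamma>) C \<Longrightarrow> ded L T \<Gamma> C"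
| NegI: "wf_fm L A \<Longrightarrow> ded L T (A # \<Gamma>) B \<Longrightarrow> ded L T (A # \<Gamma>) (\<^bold>\<not> B) \<Longrightarrow> ded L T \<Gamma> (\<^bold>\<not> A)"
| NegE: "ded L T \<Gamma> A \<Longrightarrow> ded L T \<Gamma> (\<^bold>\<not> A) \<Longrightarrow> wf_fm L B \<Longrightarrow> ded L T \<Gamma> B"
| AllNI: "ded L T (map liftN \<Gamma>) A \<Longrightarrow> ded L T \<Gamma> (AllN A)"
| AllNE: "ded L T \<Gamma> (AllN A) \<Longrightarrow> wf_trm L t \<Longrightarrow> ded L T \<Gamma> (instN A t)"
| ExNI: "wf_fm L A \<Longrightarrow> wf_trm L t \<Longrightarrow> ded L T \<Gamma> (instN A t) \<Longrightarrow> ded L T \<Gamma> (ExN A)"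
| ExNE: "ded L T \<Gamma> (ExN A) \<Longrightarrow> ded L T (A # map liftN \<Gamma>) (liftN B) \<Longrightarrow> ded L T \<Gamma> B"
| AllFI: "ded L T (map liftF \<Gamma>) A \<Longrightarrow> ded L T \<Gamma> (AllF A)"
| AllFE: "ded L T \<Gamma> (AllF A) \<Longrightarrow> wf_fnc L u \<Longrightarrow> ded L T \<Gamma> (instF A u)"
| ExFI: "wf_fm L A \<Longrightarrow> wf_fnc L u \<Longrightarrow> ded L T \<Gamma> (instF A u) \<Longrightarrow> ded L T \<Gamma> (ExF A)"
| ExFE: "ded L T \<Gamma> (ExF A) \<Longrightarrow> ded L T (A # map liftF \<Gamma>) (liftF B) \<Longrightarrow> ded L T \<Gamma> B"

definition provable :: "'c lang \<Rightarrow> 'c fm set \<Rightarrow> 'c fm \<Rightarrow> bool" where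
  "provable L T A \<longleftrightarrow> ded L T [] A"

section \<open>Abbreviations and schemata\<close>

definition capp :: "'c \<Rightarrow> 'c trm list \<Rightarrow> 'c fnc list \<Rightarrow> 'c trm" where
  "capp c ts us = (if length ts = 1 \<and> us = [] then App (FCon c) (hd ts) else Con c ts us)"

definition Zero :: "'c lang \<Rightarrow> 'c trm" where "Zero L = Con (zeroC L) [] []"
definition Succ :: "'c lang \<Rightarrow> 'c trm \<Rightarrow> 'c trm" where "Succ L t = App (FCon (sucC L)) t"

definition Iff :: "'c fm \<Rightarrow> 'c fm \<Rightarrow> 'c fm" where
  "Iff A B = ((A \<^bold>\<longrightarrow> B) \<^bold>\<and> (B \<^bold>\<longrightarrow> A))"

text \<open>\<open>s \<le> t\<close> abbreviates \<open>\<exists>z. s + z = t\<close>.\<close>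

definition Le :: "'c lang \<Rightarrow> 'c trm \<Rightarrow> 'c trm \<Rightarrow> 'c fm" where
  "Le L s t = ExN (Con (plusC L) [ren_trm Suc id s, NVar 0] [] \<doteq> ren_trm Suc id t)"

text \<open>\<open>\<exists>y[B(y) & \<forall>z(B(z) \<rightarrow> y = z)]\<close>, where \<open>y\<close> has index \<open>0\<close> in \<open>B\<close>.\<close>

definition ExN1 :: "'c fm \<Rightarrow> 'c fm" where
  "ExN1 B = ExN (B \<^bold>\<and> AllN (ren_fm (case_nat 0 (\<lambda>n. n + 2)) id B \<^bold>\<longrightarrow> NVar 1 \<doteq> NVar 0))"

text \<open>In \<open>A(x, y)\<close> the variables \<open>y\<close> and \<open>x\<close> have the indices \<open>0\<close> and \<open>1\<close>; the following is
  \<open>\<exists>\<alpha>\<forall>x A(x, \<alpha>(x))\<close>.  Shifting the function variables of \<open>A\<close> keeps \<open>\<alpha>\<close> out of \<open>A\<close>.\<close>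

definition choice_fun :: "'c fm \<Rightarrow> 'c fm" where
  "choice_fun A =
     ExF (AllN (sub_fm (case_nat (App (FVar 0) (NVar 0)) NVar) (\<lambda>n. FVar (Suc n)) A))"

definition AC00_unique :: "'c lang \<Rightarrow> 'c fm set" where
  "AC00_unique L = {AllN (ExN1 A) \<^bold>\<longrightarrow> choice_fun A | A. wf_fm L A}"

definition QF_AC00 :: "'c lang \<Rightarrow> 'c fm set" where
  "QF_AC00 L = {AllN (ExN A) \<^bold>\<longrightarrow> choice_fun A | A. wf_fm L A \<and> quantifier_free A}"

definition CF_d :: "'c lang \<Rightarrow> 'c fm set" where
  "CF_d L =
     {AllN (B \<^bold>\<or> \<^bold>\<not> B) \<^bold>\<longrightarrow>
      ExF (AllN (Le L (App (FVar 0) (NVar 0)) (Succ L (Zero L)) \<^bold>\<and>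
                 Iff (App (FVar 0) (NVar 0) \<doteq> Zero L) (liftF B))) | B. wf_fm L B}"

definition lambda_conversion :: "'c lang \<Rightarrow> 'c fm set" where
  "lambda_conversion L = {App (Lam t) s \<doteq> instT t s | t s. wf_trm L t \<and> wf_trm L s}"

text \<open>The conclusion is generalized, which keeps the induction variable bound throughout.\<close>

definition induction_schema :: "'c lang \<Rightarrow> 'c fm set" where
  "induction_schema L =
     {instN A (Zero L) \<^bold>\<and>
      AllN (A \<^bold>\<longrightarrow> sub_fm (case_nat (Succ L (NVar 0)) (\<lambda>n. NVar (Suc n))) FVar A) \<^bold>\<longrightarrow>
      AllN A | A. wf_fm L A}"

section \<open>The system \<open>IA\<^sub>1\<close>\<close>

datatype ia_const =
    IZero | ISuc | IAdd | IMul | IExp | IFact | IPred | IMinus | IMin | IMax | ISg | ISgbar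
  | IDist | IRem | IQuo | ISum | IProd | IMinF | IMaxF | IPrime | IExpo | ILh | IConc
  | IBar | ITilde | ILub | ICcp

type_synonym ia_trm = "ia_const trm"
type_synonym ia_fnc = "ia_const fnc"

text \<open>
  Definitions of a new constant \<open>f\<close> with number arguments \<open>x\<^sub>0, \<dots>\<close> (\<open>NVar 0, \<dots>\<close>) and function
  arguments \<open>\<alpha>\<^sub>0, \<dots>\<close> (\<open>FVar 0, \<dots>\<close>).  \<open>Explicit k l t\<close> stands for
  \<open>f(x\<^sub>0,\<dots>,x\<^sub>k\<^sub>-\<^sub>1,\<alpha>\<^sub>0,\<dots>,\<alpha>\<^sub>l\<^sub>-\<^sub>1) = t\<close>, and \<open>PrimRec k l g h\<close> for \<open>f(0,x,\<alpha>) = g\<close> and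
  \<open>f(y',x,\<alpha>) = h\<close>, where \<open>y\<close> and \<open>f(y,x,\<alpha>)\<close> are \<open>NVar k\<close> and \<open>NVar (k + 1)\<close> in \<open>h\<close>.

  The computation-tree constant \<open>ccp\<close> enters \<open>IA\<^sub>1\<close> through a parameter of this type: \<open>IA\<^sub>1\<close> is
  set up for every explicit or primitive recursive definition of \<open>ccp\<close> from the other
  constants, so statements about all of them cover Kleene's choice.
\<close>

datatype ia_defn =
    Explicit nat nat ia_trm
  | PrimRec nat nat ia_trm ia_trm

fun defn_arity :: "ia_defn \<Rightarrow> nat \<times> nat" where
  "defn_arity (Explicit k l t) = (k, l)"
| "defn_arity (PrimRec k l g h) = (Suc k, l)"

fun ia_arity :: "ia_const \<Rightarrow> nat \<times> nat" where
  "ia_arity IZero = (0, 0)"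
| "ia_arity ISuc = (1, 0)"
| "ia_arity IFact = (1, 0)"
| "ia_arity IPred = (1, 0)"
| "ia_arity ISg = (1, 0)"
| "ia_arity ISgbar = (1, 0)"
| "ia_arity IPrime = (1, 0)"
| "ia_arity ILh = (1, 0)"
| "ia_arity ISum = (1, 1)"
| "ia_arity IProd = (1, 1)"
| "ia_arity IMinF = (1, 1)"
| "ia_arity IMaxF = (1, 1)"
| "ia_arity IBar = (1, 1)"
| "ia_arity ITilde = (1, 1)"
| "ia_arity _ = (2, 0)"

definition IA_lang :: "ia_defn \<Rightarrow> ia_const lang" where
  "IA_lang d = \<lparr>arity = (\<lambda>c. Some (if c = ICcp then defn_arity d else ia_arity c)),
                zeroC = IZero, sucC = ISuc, plusC = IAdd\<rparr>"

definition IA_lang_without_ccp :: "ia_const lang" where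
  "IA_lang_without_ccp = \<lparr>arity = (\<lambda>c. if c = ICcp then None else Some (ia_arity c)),
                zeroC = IZero, sucC = ISuc, plusC = IAdd\<rparr>"

text \<open>All free number variables are below \<open>k\<close>, all free function variables below \<open>l\<close>.\<close>

fun bnd_trm :: "nat \<Rightarrow> nat \<Rightarrow> 'c trm \<Rightarrow> bool" and bnd_fnc :: "nat \<Rightarrow> nat \<Rightarrow> 'c fnc \<Rightarrow> bool" where
  "bnd_trm k l (NVar n) \<longleftrightarrow> n < k"
| "bnd_trm k l (App u t) \<longleftrightarrow> bnd_fnc k l u \<and> bnd_trm k l t"
| "bnd_trm k l (Con c ts us) \<longleftrightarrow> (\<forall>t \<in> set ts. bnd_trm k l t) \<and> (\<forall>u \<in> set us. bnd_fnc k l u)"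
| "bnd_fnc k l (FVar n) \<longleftrightarrow> n < l"
| "bnd_fnc k l (FCon c) \<longleftrightarrow> True"
| "bnd_fnc k l (Lam t) \<longleftrightarrow> bnd_trm (Suc k) l t"

fun wf_defn :: "ia_defn \<Rightarrow> bool" where
  "wf_defn (Explicit k l t) \<longleftrightarrow> wf_trm IA_lang_without_ccp t \<and> bnd_trm k l t"
| "wf_defn (PrimRec k l g h) \<longleftrightarrow>
     wf_trm IA_lang_without_ccp g \<and> bnd_trm k l g \<and>
     wf_trm IA_lang_without_ccp h \<and> bnd_trm (k + 2) l h"

abbreviation nvars :: "nat \<Rightarrow> 'c trm list" where "nvars k \<equiv> map NVar [0..<k]"
abbreviation fvars :: "nat \<Rightarrow> 'c fnc list" where "fvars l \<equiv> map FVar [0..<l]"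

abbreviation iZ :: ia_trm ("\<^bold>0") where "\<^bold>0 \<equiv> Con IZero [] []"
abbreviation iS :: "ia_trm \<Rightarrow> ia_trm" where "iS t \<equiv> App (FCon ISuc) t"

fun ccp_axioms :: "ia_defn \<Rightarrow> ia_const fm set" where
  "ccp_axioms (Explicit k l t) = {capp ICcp (nvars k) (fvars l) \<doteq> t}"
| "ccp_axioms (PrimRec k l g h) =
     {capp ICcp (\<^bold>0 # nvars k) (fvars l) \<doteq> g,
      capp ICcp (iS (NVar k) # nvars k) (fvars l) \<doteq>
        sub_trm (\<lambda>n. if n = k + 1 then capp ICcp (NVar k # nvars k) (fvars l) else NVar n)
          FVar h}"

abbreviation iAdd :: "ia_trm \<Rightarrow> ia_trm \<Rightarrow> ia_trm" (infixl "\<^bold>+" 65) where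
  "s \<^bold>+ t \<equiv> Con IAdd [s, t] []"
abbreviation iMul :: "ia_trm \<Rightarrow> ia_trm \<Rightarrow> ia_trm" (infixl "\<^bold>*" 70) where
  "s \<^bold>* t \<equiv> Con IMul [s, t] []"
abbreviation iExp :: "ia_trm \<Rightarrow> ia_trm \<Rightarrow> ia_trm" (infixr "\<^bold>^" 80) where
  "s \<^bold>^ t \<equiv> Con IExp [s, t] []"
abbreviation iMinus :: "ia_trm \<Rightarrow> ia_trm \<Rightarrow> ia_trm" (infixl "\<^bold>-" 65) where
  "s \<^bold>- t \<equiv> Con IMinus [s, t] []"
abbreviation "iFact t \<equiv> App (FCon IFact) t"
abbreviation "iPred t \<equiv> App (FCon IPred) t"
abbreviation "iMin s t \<equiv> Con IMin [s, t] []"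
abbreviation "iMax s t \<equiv> Con IMax [s, t] []"
abbreviation "iSg t \<equiv> App (FCon ISg) t"
abbreviation "iSgbar t \<equiv> App (FCon ISgbar) t"
abbreviation "iDist s t \<equiv> Con IDist [s, t] []"
abbreviation "iRem s t \<equiv> Con IRem [s, t] []"
abbreviation "iQuo s t \<equiv> Con IQuo [s, t] []"
abbreviation "iSum z u \<equiv> Con ISum [z] [u]"
abbreviation "iProd z u \<equiv> Con IProd [z] [u]"
abbreviation "iMinF z u \<equiv> Con IMinF [z] [u]"
abbreviation "iMaxF z u \<equiv> Con IMaxF [z] [u]"
abbreviation "iPrime t \<equiv> App (FCon IPrime) t"
abbreviation "iExpo s t \<equiv> Con IExpo [s, t] []"
abbreviation "iLh t \<equiv> App (FCon ILh) t"
abbreviation "iConc s t \<equiv> Con IConc [s, t] []"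
abbreviation "iBar t u \<equiv> Con IBar [t] [u]"
abbreviation "iTilde t u \<equiv> Con ITilde [t] [u]"
abbreviation "iLub s t \<equiv> Con ILub [s, t] []"

text \<open>
  The equations below use, with \<open>Lam\<close>-bound indices shifted accordingly:
  \<^item> \<open>p\<^sub>i\<^sub>' = \<Sum>\<^bsub>x < p\<^sub>i! + 2\<^esub> \<Prod>\<^bsub>y \<le> x\<^esub> sgbar(sg(y - p\<^sub>i) * \<Prod>\<^bsub>c < y - 2\<^esub> sg(rm(y, c + 2)))\<close>,
    the least \<open>y < p\<^sub>i! + 2\<close> above \<open>p\<^sub>i\<close> without divisor \<open>d\<close>, \<open>2 \<le> d < y\<close>;
  \<^item> \<open>(a)\<^sub>i = \<Sum>\<^bsub>x < a\<^esub> sgbar(rm(a, p\<^sub>i^(x + 1)))\<close>, the number of positive powers of \<open>p\<^sub>i\<close>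
    dividing \<open>a\<close> (and \<open>0\<close> for \<open>a = 0\<close>).
\<close>

definition ia_defining_equations :: "ia_const fm set" where
  "ia_defining_equations =
    (let a = NVar 0; b = NVar 1; \<alpha> = FVar 0; one = iS \<^bold>0; two = iS one in
     {a \<^bold>+ \<^bold>0 \<doteq> a,
      a \<^bold>+ iS b \<doteq> iS (a \<^bold>+ b),
      a \<^bold>* \<^bold>0 \<doteq> \<^bold>0,
      a \<^bold>* iS b \<doteq> a \<^bold>* b \<^bold>+ a,
      a \<^bold>^ \<^bold>0 \<doteq> one,
      a \<^bold>^ iS b \<doteq> a \<^bold>^ b \<^bold>* a,
      iFact \<^bold>0 \<doteq> one,
      iFact (iS a) \<doteq> iFact a \<^bold>* iS a,
      iPred \<^bold>0 \<doteq> \<^bold>0,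
      iPred (iS a) \<doteq> a,
      a \<^bold>- \<^bold>0 \<doteq> a,
      a \<^bold>- iS b \<doteq> iPred (a \<^bold>- b),
      iMin a b \<doteq> b \<^bold>- (b \<^bold>- a),
      iMax a b \<doteq> (a \<^bold>- b) \<^bold>+ b,
      iSg \<^bold>0 \<doteq> \<^bold>0,
      iSg (iS a) \<doteq> one,
      iSgbar \<^bold>0 \<doteq> one,
      iSgbar (iS a) \<doteq> \<^bold>0,
      iDist a b \<doteq> (a \<^bold>- b) \<^bold>+ (b \<^bold>- a),
      iRem \<^bold>0 b \<doteq> \<^bold>0,
      iRem (iS a) b \<doteq> iS (iRem a b) \<^bold>* iSg (iDist b (iS (iRem a b))),
      iQuo \<^bold>0 b \<doteq> \<^bold>0,
      iQuo (iS a) b \<doteq> iQuo a b \<^bold>+ iSgbar (iDist b (iS (iRem a b))),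
      iSum \<^bold>0 \<alpha> \<doteq> \<^bold>0,
      iSum (iS a) \<alpha> \<doteq> iSum a \<alpha> \<^bold>+ App \<alpha> a,
      iProd \<^bold>0 \<alpha> \<doteq> one,
      iProd (iS a) \<alpha> \<doteq> iProd a \<alpha> \<^bold>* App \<alpha> a,
      iMinF \<^bold>0 \<alpha> \<doteq> App \<alpha> \<^bold>0,
      iMinF (iS a) \<alpha> \<doteq> iMin (iMinF a \<alpha>) (App \<alpha> (iS a)),
      iMaxF \<^bold>0 \<alpha> \<doteq> App \<alpha> \<^bold>0,
      iMaxF (iS a) \<alpha> \<doteq> iMax (iMaxF a \<alpha>) (App \<alpha> (iS a)),
      iPrime \<^bold>0 \<doteq> two,
      iPrime (iS a) \<doteq>
        iSum (iS (iS (iFact (iPrime a))))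
          (Lam (iProd (iS (NVar 0))
            (Lam (iSgbar
              (iSg (NVar 0 \<^bold>- iPrime (NVar 2)) \<^bold>*
               iProd (NVar 0 \<^bold>- two) (Lam (iSg (iRem (NVar 1) (iS (iS (NVar 0)))))))))) ),
      iExpo a b \<doteq> iSum a (Lam (iSgbar (iRem (NVar 1) (iPrime (NVar 2) \<^bold>^ iS (NVar 0))))),
      iLh a \<doteq> iSum a (Lam (iSg (iExpo (NVar 1) (NVar 0)))),
      iConc a b \<doteq>
        a \<^bold>* iProd (iLh b)
              (Lam (iPrime (iLh (NVar 1) \<^bold>+ NVar 0) \<^bold>^ iExpo (NVar 2) (NVar 0))),
      iBar a \<alpha> \<doteq> iProd a (Lam (iPrime (NVar 0) \<^bold>^ iS (App \<alpha> (NVar 0)))),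
      iTilde a \<alpha> \<doteq> iProd a (Lam (iPrime (NVar 0) \<^bold>^ App \<alpha> (NVar 0))),
      iLub a b \<doteq>
        iProd (iMax a b)
          (Lam (iPrime (NVar 0) \<^bold>^ iMax (iExpo (NVar 1) (NVar 0)) (iExpo (NVar 2) (NVar 0))))})"

definition ia_arithmetic :: "ia_const fm set" where
  "ia_arithmetic =
    (let a = NVar 0; b = NVar 1; c = NVar 2; \<alpha> = FVar 0 in
     {\<^bold>\<not> (iS a \<doteq> \<^bold>0),
      iS a \<doteq> iS b \<^bold>\<longrightarrow> a \<doteq> b,
      a \<doteq> b \<^bold>\<longrightarrow> iS a \<doteq> iS b,
      a \<doteq> a,
      a \<doteq> b \<^bold>\<longrightarrow> a \<doteq> c \<^bold>\<longrightarrow> b \<doteq> c,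
      a \<doteq> b \<^bold>\<longrightarrow> App \<alpha> a \<doteq> App \<alpha> b})"

definition IA1 :: "ia_defn \<Rightarrow> ia_const fm set" where
  "IA1 d = ia_arithmetic \<union> ia_defining_equations \<union> ccp_axioms d \<union>
           lambda_conversion (IA_lang d) \<union> induction_schema (IA_lang d)"

section \<open>The system \<open>HA\<^sub>1\<close>\<close>

text \<open>
  Primitive recursive descriptions.  \<open>PZero n\<close> is the \<open>n\<close>-place zero function, \<open>PComp n f gs\<close>
  composes \<open>f\<close> with the \<open>n\<close>-place functions \<open>gs\<close>, and \<open>PRec n g h\<close> is the \<open>(n + 1)\<close>-place
  function \<open>f(0,x) = g(x)\<close>, \<open>f(S(y),x) = h(y,f(y,x),x)\<close>.
\<close>

datatype pr = PSuc | PZero nat | PProj nat nat | PComp nat pr "pr list" | PRec nat pr pr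

fun pr_arity :: "pr \<Rightarrow> nat" where
  "pr_arity PSuc = 1"
| "pr_arity (PZero n) = n"
| "pr_arity (PProj n i) = n"
| "pr_arity (PComp n f gs) = n"
| "pr_arity (PRec n g h) = Suc n"

fun wf_pr :: "pr \<Rightarrow> bool" where
  "wf_pr PSuc \<longleftrightarrow> True"
| "wf_pr (PZero n) \<longleftrightarrow> True"
| "wf_pr (PProj n i) \<longleftrightarrow> i < n"
| "wf_pr (PComp n f gs) \<longleftrightarrow>
     wf_pr f \<and> pr_arity f = length gs \<and> (\<forall>g \<in> set gs. wf_pr g \<and> pr_arity g = n)"
| "wf_pr (PRec n g h) \<longleftrightarrow> wf_pr g \<and> pr_arity g = n \<and> wf_pr h \<and> pr_arity h = n + 2"

datatype ha_const = HZero | HPR pr | HRec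

type_synonym ha_trm = "ha_const trm"

definition pr_add :: pr where
  "pr_add = PRec 1 (PProj 1 0) (PComp 3 PSuc [PProj 3 1])"
definition pr_mult :: pr where
  "pr_mult = PRec 1 (PZero 1) (PComp 3 pr_add [PProj 3 1, PProj 3 2])"

text \<open>\<open>pr_power(y, x) = x^y\<close>\<close>

definition pr_power :: pr where
  "pr_power = PRec 1 (PComp 1 PSuc [PZero 1]) (PComp 3 pr_mult [PProj 3 1, PProj 3 2])"

text \<open>\<open>rec(t, u, s)\<close> is \<open>Con HRec [t, s] [u]\<close>.\<close>

definition HA_lang :: "ha_const lang" where
  "HA_lang = \<lparr>arity = (\<lambda>c. case c of HZero \<Rightarrow> Some (0, 0)
                        | HPR f \<Rightarrow> (if wf_pr f then Some (pr_arity f, 0) else None)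
                        | HRec \<Rightarrow> Some (2, 1)),
              zeroC = HZero, sucC = HPR PSuc, plusC = HPR pr_add\<rparr>"

abbreviation hZ :: ha_trm where "hZ \<equiv> Con HZero [] []"
abbreviation hS :: "ha_trm \<Rightarrow> ha_trm" where "hS t \<equiv> App (FCon (HPR PSuc)) t"
abbreviation hF :: "pr \<Rightarrow> ha_trm list \<Rightarrow> ha_trm" where "hF f ts \<equiv> capp (HPR f) ts []"

text \<open>\<open>\<langle>s, t\<rangle> = 2^s * 3^t\<close>\<close>

definition hPair :: "ha_trm \<Rightarrow> ha_trm \<Rightarrow> ha_trm" where
  "hPair s t = hF pr_mult [hF pr_power [s, hS (hS hZ)], hF pr_power [t, hS (hS (hS hZ))]]"

fun pr_equations :: "pr \<Rightarrow> ha_const fm set" where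
  "pr_equations PSuc = {}"
| "pr_equations (PZero n) = {hF (PZero n) (nvars n) \<doteq> hZ}"
| "pr_equations (PProj n i) = {hF (PProj n i) (nvars n) \<doteq> NVar i}"
| "pr_equations (PComp n f gs) =
     {hF (PComp n f gs) (nvars n) \<doteq> hF f (map (\<lambda>g. hF g (nvars n)) gs)}"
| "pr_equations (PRec n g h) =
     {hF (PRec n g h) (hZ # nvars n) \<doteq> hF g (nvars n),
      hF (PRec n g h) (hS (NVar n) # nvars n) \<doteq>
        hF h (NVar n # hF (PRec n g h) (NVar n # nvars n) # nvars n)}"

definition replacement_schema :: "'c lang \<Rightarrow> 'c fm set" where
  "replacement_schema L =
     {instN A (NVar x) \<^bold>\<and> NVar x \<doteq> NVar y \<^bold>\<longrightarrow> instN A (NVar y) | A x y. wf_fm L A}"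

definition rec_axioms :: "ha_const fm set" where
  "rec_axioms =
     {Con HRec [t, hZ] [u] \<doteq> t | t u. wf_trm HA_lang t \<and> wf_fnc HA_lang u} \<union>
     {Con HRec [t, hS s] [u] \<doteq> App u (hPair (Con HRec [t, s] [u]) s) | t s u.
        wf_trm HA_lang t \<and> wf_trm HA_lang s \<and> wf_fnc HA_lang u}"

definition HA1 :: "ha_const fm set" where
  "HA1 = {NVar 0 \<doteq> NVar 0, \<^bold>\<not> (hS hZ \<doteq> hZ)} \<union> replacement_schema HA_lang \<union>
         (\<Union>f \<in> {f. wf_pr f}. pr_equations f) \<union> rec_axioms \<union>
         lambda_conversion HA_lang \<union> induction_schema HA_lang"

end

theory Submission
  imports Defs
begin

text \<open>
  Let \<open>\<forall>x\<exists>!y A(x,y)\<close>, and let \<open>B(z)\<close> say that \<open>z\<close> is the code of a pair \<open>(x, y)\<close> with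
  \<open>A(x,y)\<close>.  Every number codes exactly one pair under Cantor's pairing, the value belonging to
  \<open>x\<close> exists, and equality of numbers is decidable; so \<open>B\<close> is decidable, and \<open>CF\<^sub>d\<close> yields
  its characteristic function \<open>\<beta>\<close>.  Applying \<open>QF-AC\<^sub>0\<^sub>0\<close> to \<open>\<beta>(\<langle>x,y\<rangle>) = 0\<close> gives the choice
  function.

  Cantor's function \<open>\<langle>x,y\<rangle> = (0 + \<dots> + (x + y)) + x\<close> is used instead of prime powers because
  it satisfies \<open>\<langle>0,0\<rangle> = 0\<close>, \<open>\<langle>x',y\<rangle> = \<langle>x,y'\<rangle>'\<close> and \<open>\<langle>0,y'\<rangle> = \<langle>y,0\<rangle>'\<close>, from which its bijectivity
  follows by a single induction on the code.
\<close>

section \<open>Calculus of substitutions\<close>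

text \<open>Two restrictions shape the argument. \<open>CF_d\<close> yields one-place functions
  only, which forces a pairing, and quantifier-free choice accepts no quantifiers, which is why
  A(x,y) is traded for a prime formula about \<beta>. Uniqueness makes the trade possible: once the
  value y0 belonging to x is at hand, A(x,y) amounts to y0 = y. Everything is derived inside the
  formal systems, most of whose axioms speak of particular variables. Using them for arbitrary terms
  and functors under assumptions requires derivations to be closed under substitution, although the
  set of axioms need not be. The systems also offer different starting points. IA1 states equality
  axioms for variables only, so replacement in formulas has to be won from lambda-conversion. HA1
  has a replacement schema for variables, but about the successor it postulates only that 1 differs
  from 0; injectivity and the general inequality come from suitable primitive recursive functions.
  An abstract addition and an abstract triangular-number function, given by their recursion
  equations, let the common argument be carried out once for both.\<close>

lemma up_simps [simp]: "up r 0 = 0" "up r (Suc n) = Suc (r n)"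
  by (simp_all add: up_def)

lemma upN_trm_simps [simp]:
  "upN_trm \<sigma> 0 = NVar 0" "upN_trm \<sigma> (Suc n) = ren_trm Suc id (\<sigma> n)"
  by (simp_all add: upN_trm_def)

lemma up_eq_sub [simp]:
  "upN_trm (\<lambda>n. NVar (r n)) = (\<lambda>n. NVar (up r n))"
  "upN_fnc (\<lambda>n. FVar (q n)) = (\<lambda>n. FVar (q n))"
  "upF_trm (\<lambda>n. NVar (r n)) = (\<lambda>n. NVar (r n))"
  "upF_fnc (\<lambda>n. FVar (q n)) = (\<lambda>n. FVar (up q n))"
  by (auto simp: fun_eq_iff upN_trm_def upN_fnc_def upF_trm_def upF_fnc_def up_def split: nat.split)

lemma up_id [simp]: "up (\<lambda>n. n) = (\<lambda>n. n)"
  by (auto simp: fun_eq_iff up_def split: nat.split)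

text \<open>Renaming becomes substitution by variables, so laws proved for substitution also yield
  laws for renaming, such as \<open>ren_ren_trm\<close>.\<close>

lemma fixes t :: "'c trm" and u :: "'c fnc"
  shows ren_trm_eq_sub: "ren_trm r q t = sub_trm (\<lambda>n. NVar (r n)) (\<lambda>n. FVar (q n)) t"
  and ren_fnc_eq_sub: "ren_fnc r q u = sub_fnc (\<lambda>n. NVar (r n)) (\<lambda>n. FVar (q n)) u"
  by (induction t and u arbitrary: r q and r q) auto

lemma ren_fm_eq_sub: "ren_fm r q A = sub_fm (\<lambda>n. NVar (r n)) (\<lambda>n. FVar (q n)) A"
  by (induction A arbitrary: r q) (auto simp: ren_trm_eq_sub)

lemma fixes t :: "'c trm" and u :: "'c fnc"
  shows sub_trm_id [simp]: "sub_trm NVar FVar t = t"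
  and sub_fnc_id [simp]: "sub_fnc NVar FVar u = u"
  using up_eq_sub[of "\<lambda>n. n"]
  by (induction t and u) (auto simp: map_idI)

lemma sub_fm_id [simp]: "sub_fm NVar FVar A = A"
  using up_eq_sub[of "\<lambda>n. n"] by (induction A) auto

lemma upN_trm_up: "(\<lambda>n. upN_trm \<sigma> (up r n)) = upN_trm (\<lambda>n. \<sigma> (r n))"
  by (auto simp: fun_eq_iff upN_trm_def up_def split: nat.split)

text \<open>The order of the composition laws is forced: passing a substitution under a binder
  renames its values, so the mixed laws for renaming and substitution must precede
  \<open>sub_sub_trm\<close>.\<close>

lemma fixes t :: "'c trm" and u :: "'c fnc"
  shows sub_ren_trm: "sub_trm \<sigma> \<tau> (ren_trm r q t) = sub_trm (\<lambda>n. \<sigma> (r n)) (\<lambda>n. \<tau> (q n)) t"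
  and sub_ren_fnc: "sub_fnc \<sigma> \<tau> (ren_fnc r q u) = sub_fnc (\<lambda>n. \<sigma> (r n)) (\<lambda>n. \<tau> (q n)) u"
  by (induction t and u arbitrary: \<sigma> \<tau> r q and \<sigma> \<tau> r q)
     (auto simp: upN_trm_up upN_fnc_def)

lemma ren_ren_trm: "ren_trm r q (ren_trm r' q' t) = ren_trm (\<lambda>n. r (r' n)) (\<lambda>n. q (q' n)) t"
  and ren_ren_fnc: "ren_fnc r q (ren_fnc r' q' u) = ren_fnc (\<lambda>n. r (r' n)) (\<lambda>n. q (q' n)) u"
  by (simp_all add: ren_trm_eq_sub[of r q] ren_fnc_eq_sub[of r q] sub_ren_trm sub_ren_fnc)
     (simp_all add: ren_trm_eq_sub ren_fnc_eq_sub)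

lemma upN_ren:
  "(\<lambda>n. ren_trm (up r) q (upN_trm \<sigma> n)) = upN_trm (\<lambda>n. ren_trm r q (\<sigma> n))"
  "(\<lambda>n. ren_fnc (up r) q (upN_fnc \<tau> n)) = upN_fnc (\<lambda>n. ren_fnc r q (\<tau> n))"
  by (auto simp: fun_eq_iff upN_trm_def upN_fnc_def ren_ren_trm ren_ren_fnc split: nat.split)

lemma fixes t :: "'c trm" and u :: "'c fnc"
  shows ren_sub_trm: "ren_trm r q (sub_trm \<sigma> \<tau> t) =
    sub_trm (\<lambda>n. ren_trm r q (\<sigma> n)) (\<lambda>n. ren_fnc r q (\<tau> n)) t"
  and ren_sub_fnc: "ren_fnc r q (sub_fnc \<sigma> \<tau> u) =
    sub_fnc (\<lambda>n. ren_trm r q (\<sigma> n)) (\<lambda>n. ren_fnc r q (\<tau> n)) u"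
  by (induction t and u arbitrary: \<sigma> \<tau> r q and \<sigma> \<tau> r q) (auto simp: upN_ren)

lemma upN_sub:
  "(\<lambda>n. sub_trm (upN_trm \<sigma>) (upN_fnc \<tau>) (upN_trm \<sigma>' n)) = upN_trm (\<lambda>n. sub_trm \<sigma> \<tau> (\<sigma>' n))"
  "(\<lambda>n. sub_fnc (upN_trm \<sigma>) (upN_fnc \<tau>) (upN_fnc \<tau>' n)) = upN_fnc (\<lambda>n. sub_fnc \<sigma> \<tau> (\<tau>' n))"
  by (auto simp: fun_eq_iff upN_trm_def upN_fnc_def sub_ren_trm sub_ren_fnc ren_sub_trm ren_sub_fnc
           split: nat.split)

lemma upF_sub:
  "(\<lambda>n. sub_trm (upF_trm \<sigma>) (upF_fnc \<tau>) (upF_trm \<sigma>' n)) = upF_trm (\<lambda>n. sub_trm \<sigma> \<tau> (\<sigma>' n))"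
  "(\<lambda>n. sub_fnc (upF_trm \<sigma>) (upF_fnc \<tau>) (upF_fnc \<tau>' n)) = upF_fnc (\<lambda>n. sub_fnc \<sigma> \<tau> (\<tau>' n))"
  by (auto simp: fun_eq_iff upF_trm_def upF_fnc_def sub_ren_trm sub_ren_fnc ren_sub_trm ren_sub_fnc
           split: nat.split)

lemma fixes t :: "'c trm" and u :: "'c fnc"
  shows sub_sub_trm: "sub_trm \<sigma> \<tau> (sub_trm \<sigma>' \<tau>' t) =
    sub_trm (\<lambda>n. sub_trm \<sigma> \<tau> (\<sigma>' n)) (\<lambda>n. sub_fnc \<sigma> \<tau> (\<tau>' n)) t"
  and sub_sub_fnc: "sub_fnc \<sigma> \<tau> (sub_fnc \<sigma>' \<tau>' u) =
    sub_fnc (\<lambda>n. sub_trm \<sigma> \<tau> (\<sigma>' n)) (\<lambda>n. sub_fnc \<sigma> \<tau> (\<tau>' n)) u"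
  by (induction t and u arbitrary: \<sigma> \<tau> \<sigma>' \<tau>' and \<sigma> \<tau> \<sigma>' \<tau>') (auto simp: upN_sub)

lemma sub_sub_fm: "sub_fm \<sigma> \<tau> (sub_fm \<sigma>' \<tau>' A) =
    sub_fm (\<lambda>n. sub_trm \<sigma> \<tau> (\<sigma>' n)) (\<lambda>n. sub_fnc \<sigma> \<tau> (\<tau>' n)) A"
  by (induction A arbitrary: \<sigma> \<tau> \<sigma>' \<tau>') (auto simp: upN_sub upF_sub sub_sub_trm)

lemma sub_fm_cong:
  "(\<And>n. \<sigma> n = \<sigma>' n) \<Longrightarrow> (\<And>n. \<tau> n = \<tau>' n) \<Longrightarrow> sub_fm \<sigma> \<tau> A = sub_fm \<sigma>' \<tau>' A"
  by (metis ext)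

lemma sub_trm_cong:
  "(\<And>n. \<sigma> n = \<sigma>' n) \<Longrightarrow> (\<And>n. \<tau> n = \<tau>' n) \<Longrightarrow> sub_trm \<sigma> \<tau> t = sub_trm \<sigma>' \<tau>' t"
  by (metis ext)

text \<open>A normal form for the commutation laws below: both sides turn into a single simultaneous
  substitution, and these are compared variable by variable.\<close>

lemmas to_sub = ren_trm_eq_sub ren_fnc_eq_sub ren_fm_eq_sub instN_def instF_def instT_def
  upN_trm_def upN_fnc_def upF_trm_def upF_fnc_def
  sub_sub_trm sub_sub_fnc sub_sub_fm

lemma sub_instN:
  "sub_fm \<sigma> \<tau> (instN A t) = instN (sub_fm (upN_trm \<sigma>) (upN_fnc \<tau>) A) (sub_trm \<sigma> \<tau> t)"
  by (auto simp: to_sub intro!: sub_fm_cong split: nat.split)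

lemma sub_instF:
  "sub_fm \<sigma> \<tau> (instF A u) = instF (sub_fm (upF_trm \<sigma>) (upF_fnc \<tau>) A) (sub_fnc \<sigma> \<tau> u)"
  by (auto simp: to_sub intro!: sub_fm_cong split: nat.split)

lemma sub_liftN:
  "sub_fm (upN_trm \<sigma>) (upN_fnc \<tau>) (liftN A) = liftN (sub_fm \<sigma> \<tau> A)"
  by (auto simp: to_sub intro!: sub_fm_cong split: nat.split)

lemma sub_liftF:
  "sub_fm (upF_trm \<sigma>) (upF_fnc \<tau>) (liftF A) = liftF (sub_fm \<sigma> \<tau> A)"
  by (auto simp: to_sub intro!: sub_fm_cong split: nat.split)

lemma instN_sub_upN:
  "instN (sub_fm (upN_trm \<sigma>) (upN_fnc \<tau>) A) t = sub_fm (case_nat t \<sigma>) \<tau> A"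
  by (auto simp: to_sub intro!: sub_fm_cong split: nat.split)

lemma instF_sub_upF:
  "instF (sub_fm (upF_trm \<sigma>) (upF_fnc \<tau>) A) u = sub_fm \<sigma> (case_nat u \<tau>) A"
  by (auto simp: to_sub intro!: sub_fm_cong split: nat.split)

section \<open>Well-formedness under renaming and substitution\<close>

lemma fixes t :: "'c trm" and u :: "'c fnc"
  shows wf_ren_trm [simp]: "wf_trm L (ren_trm r q t) = wf_trm L t"
  and wf_ren_fnc [simp]: "wf_fnc L (ren_fnc r q u) = wf_fnc L u"
  by (induction t and u arbitrary: r q and r q) auto

lemma wf_ren_fm [simp]: "wf_fm L (ren_fm r q A) = wf_fm L A"
  by (induction A arbitrary: r q) auto

definition wf_sub :: "'c lang \<Rightarrow> (nat \<Rightarrow> 'c trm) \<Rightarrow> (nat \<Rightarrow> 'c fnc) \<Rightarrow> bool" where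
  "wf_sub L \<sigma> \<tau> \<longleftrightarrow> (\<forall>n. wf_trm L (\<sigma> n)) \<and> (\<forall>n. wf_fnc L (\<tau> n))"

lemma wf_subD: "wf_sub L \<sigma> \<tau> \<Longrightarrow> wf_trm L (\<sigma> n)" "wf_sub L \<sigma> \<tau> \<Longrightarrow> wf_fnc L (\<tau> n)"
  by (simp_all add: wf_sub_def)

lemma wf_sub_up [simp]:
  "wf_sub L \<sigma> \<tau> \<Longrightarrow> wf_sub L (upN_trm \<sigma>) (upN_fnc \<tau>)"
  "wf_sub L \<sigma> \<tau> \<Longrightarrow> wf_sub L (upF_trm \<sigma>) (upF_fnc \<tau>)"
  by (auto simp: wf_sub_def upN_trm_def upN_fnc_def upF_trm_def upF_fnc_def split: nat.split)

lemma fixes t :: "'c trm" and u :: "'c fnc"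
  shows wf_sub_trm: "wf_trm L t \<Longrightarrow> wf_sub L \<sigma> \<tau> \<Longrightarrow> wf_trm L (sub_trm \<sigma> \<tau> t)"
  and wf_sub_fnc: "wf_fnc L u \<Longrightarrow> wf_sub L \<sigma> \<tau> \<Longrightarrow> wf_fnc L (sub_fnc \<sigma> \<tau> u)"
  by (induction t and u arbitrary: \<sigma> \<tau> and \<sigma> \<tau>) (auto dest: wf_subD)

lemma wf_sub_fm: "wf_fm L A \<Longrightarrow> wf_sub L \<sigma> \<tau> \<Longrightarrow> wf_fm L (sub_fm \<sigma> \<tau> A)"
  by (induction A arbitrary: \<sigma> \<tau>) (auto simp: wf_sub_trm)

section \<open>Finite support of expressions\<close>

definition agree :: "nat \<Rightarrow> (nat \<Rightarrow> 'a) \<Rightarrow> (nat \<Rightarrow> 'a) \<Rightarrow> bool" where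
  "agree m f g \<longleftrightarrow> (\<forall>i<m. f i = g i)"

text \<open>The same bound survives a binder: indices either stay in place, or 0 is fixed and every
  other index takes its value from a smaller one.\<close>

lemma agree_up:
  "agree m \<sigma> \<sigma>' \<Longrightarrow> agree m (upN_trm \<sigma>) (upN_trm \<sigma>')"
  "agree m \<tau> \<tau>' \<Longrightarrow> agree m (upN_fnc \<tau>) (upN_fnc \<tau>')"
  "agree m \<sigma> \<sigma>' \<Longrightarrow> agree m (upF_trm \<sigma>) (upF_trm \<sigma>')"
  "agree m \<tau> \<tau>' \<Longrightarrow> agree m (upF_fnc \<tau>) (upF_fnc \<tau>')"
  by (auto simp: agree_def upN_trm_def upN_fnc_def upF_trm_def upF_fnc_def split: nat.split)

lemma agree_mono: "agree m f g \<Longrightarrow> k \<le> m \<Longrightarrow> agree k f g"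
  by (auto simp: agree_def)

text \<open>Only finitely many variables occur in an expression. In \<open>ded_sub_closed\<close>
  this makes finitely many generalizations enough to reach all of them.\<close>

lemma fixes t :: "'c trm" and u :: "'c fnc"
  shows finite_support_trm: "\<exists>m. \<forall>\<sigma> \<sigma>' \<tau> \<tau>'. agree m \<sigma> \<sigma>' \<longrightarrow> agree m \<tau> \<tau>' \<longrightarrow>
    sub_trm \<sigma> \<tau> t = sub_trm \<sigma>' \<tau>' t"
  and finite_support_fnc: "\<exists>m. \<forall>\<sigma> \<sigma>' \<tau> \<tau>'. agree m \<sigma> \<sigma>' \<longrightarrow> agree m \<tau> \<tau>' \<longrightarrow>
    sub_fnc \<sigma> \<tau> u = sub_fnc \<sigma>' \<tau>' u"
proof (induction t and u)
  case (NVar n) then show ?case by (auto simp: agree_def intro!: exI[of _ "Suc n"])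
next
  case (FVar n) then show ?case by (auto simp: agree_def intro!: exI[of _ "Suc n"])
next
  case (App u t)
  then obtain m k where "\<forall>\<sigma> \<sigma>' \<tau> \<tau>'. agree m \<sigma> \<sigma>' \<longrightarrow> agree m \<tau> \<tau>' \<longrightarrow>
    sub_trm \<sigma> \<tau> t = sub_trm \<sigma>' \<tau>' t" "\<forall>\<sigma> \<sigma>' \<tau> \<tau>'. agree k \<sigma> \<sigma>' \<longrightarrow> agree k \<tau> \<tau>' \<longrightarrow>
    sub_fnc \<sigma> \<tau> u = sub_fnc \<sigma>' \<tau>' u" by metis
  then show ?case by (intro exI[of _ "max m k"]) (simp, metis agree_mono max.cobounded1 max.cobounded2)
next
  case (Con c ts us)
  obtain f where f: "\<And>t \<sigma> \<sigma>' \<tau> \<tau>'. t \<in> set ts \<Longrightarrow> agree (f t) \<sigma> \<sigma>' \<Longrightarrow> agree (f t) \<tau> \<tau>' \<Longrightarrow>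
      sub_trm \<sigma> \<tau> t = sub_trm \<sigma>' \<tau>' t"
    using Con(1) by metis
  obtain g where g: "\<And>u \<sigma> \<sigma>' \<tau> \<tau>'. u \<in> set us \<Longrightarrow> agree (g u) \<sigma> \<sigma>' \<Longrightarrow> agree (g u) \<tau> \<tau>' \<Longrightarrow>
      sub_fnc \<sigma> \<tau> u = sub_fnc \<sigma>' \<tau>' u"
    using Con(2) by metis
  \<comment> \<open>The sum of the bounds of all arguments dominates each of them, which suffices
    because \<open>agree\<close> is antitone in its bound.\<close>
  have 1: "f t \<le> sum_list (map f ts) + sum_list (map g us)" if "t \<in> set ts" for t
    using that by (simp add: member_le_sum_list trans_le_add1)
  have 2: "g u \<le> sum_list (map f ts) + sum_list (map g us)" if "u \<in> set us" for u
    using that by (simp add: member_le_sum_list trans_le_add2)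
  show ?case
    by (intro exI[of _ "sum_list (map f ts) + sum_list (map g us)"])
       (auto intro!: f g elim: agree_mono dest: 1 2)
next
  case (Lam t)
  then show ?case by (elim exE, intro exI) (simp, blast intro: agree_up)
qed auto

lemma finite_support_binary:
  fixes f g :: "(nat \<Rightarrow> 'c trm) \<Rightarrow> (nat \<Rightarrow> 'c fnc) \<Rightarrow> 'x" and h :: "'x \<Rightarrow> 'x \<Rightarrow> 'y"
  assumes "\<exists>m. \<forall>\<sigma> \<sigma>' \<tau> \<tau>'. agree m \<sigma> \<sigma>' \<longrightarrow> agree m \<tau> \<tau>' \<longrightarrow> f \<sigma> \<tau> = f \<sigma>' \<tau>'"
    and "\<exists>m. \<forall>\<sigma> \<sigma>' \<tau> \<tau>'. agree m \<sigma> \<sigma>' \<longrightarrow> agree m \<tau> \<tau>' \<longrightarrow> g \<sigma> \<tau> = g \<sigma>' \<tau>'"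
  shows "\<exists>m. \<forall>\<sigma> \<sigma>' \<tau> \<tau>'. agree m \<sigma> \<sigma>' \<longrightarrow> agree m \<tau> \<tau>' \<longrightarrow>
    h (f \<sigma> \<tau>) (g \<sigma> \<tau>) = h (f \<sigma>' \<tau>') (g \<sigma>' \<tau>')"
proof -
  from assms obtain m k where
    "\<forall>\<sigma> \<sigma>' \<tau> \<tau>'. agree m \<sigma> \<sigma>' \<longrightarrow> agree m \<tau> \<tau>' \<longrightarrow> f \<sigma> \<tau> = f \<sigma>' \<tau>'"
    "\<forall>\<sigma> \<sigma>' \<tau> \<tau>'. agree k \<sigma> \<sigma>' \<longrightarrow> agree k \<tau> \<tau>' \<longrightarrow> g \<sigma> \<tau> = g \<sigma>' \<tau>'" by metis
  then show ?thesis
    by (intro exI[of _ "max m k"]) (metis agree_mono max.cobounded1 max.cobounded2)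
qed

lemma finite_support_fm: "\<exists>m. \<forall>\<sigma> \<sigma>' \<tau> \<tau>'. agree m \<sigma> \<sigma>' \<longrightarrow> agree m \<tau> \<tau>' \<longrightarrow>
    sub_fm \<sigma> \<tau> A = sub_fm \<sigma>' \<tau>' A"
proof (induction A)
  case (Eq s t)
  show ?case unfolding sub_fm.simps
    by (rule finite_support_binary[where h = Eq]; rule finite_support_trm)
next
  case (Neg A) then show ?case by simp
next
  case (And A B) then show ?case
    unfolding sub_fm.simps by (rule finite_support_binary[where h = And])
next
  case (Or A B) then show ?case
    unfolding sub_fm.simps by (rule finite_support_binary[where h = Or])
next
  case (Imp A B) then show ?case
    unfolding sub_fm.simps by (rule finite_support_binary[where h = Imp])
qed (elim exE, rule exI, simp, blast intro: agree_up)+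

section \<open>Derivations are closed under substitution\<close>

lemma ded_weaken: "ded L T \<Gamma> A \<Longrightarrow> set \<Gamma> \<subseteq> set \<Delta> \<Longrightarrow> ded L T \<Delta> A"
proof (induction arbitrary: \<Delta> rule: ded.induct)
  case (ImpI A \<Gamma> B)
  then show ?case by (intro ded.ImpI ImpI.IH) auto
next
  case (OrE \<Gamma> A B C)
  show ?case
    by (rule ded.OrE[of _ _ _ A B], use OrE in blast, rule OrE, use OrE in auto, rule OrE, use OrE in auto)
next
  case (NegI A \<Gamma> B)
  show ?case
    by (rule ded.NegI[of _ _ _ _ B], use NegI in blast, rule NegI, use NegI in auto, rule NegI, use NegI in auto)
next
  case (ExNE \<Gamma> A B)
  show ?case by (rule ded.ExNE[of _ _ _ A], use ExNE in blast, rule ExNE) (use ExNE.prems in auto)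
next
  case (ExFE \<Gamma> A B)
  show ?case by (rule ded.ExFE[of _ _ _ A], use ExFE in blast, rule ExFE) (use ExFE.prems in auto)
next
  case (AllNI \<Gamma> A)
  then show ?case by (intro ded.AllNI AllNI.IH) auto
next
  case (AllFI \<Gamma> A)
  then show ?case by (intro ded.AllFI AllFI.IH) auto
qed (blast intro: ded.intros)+

text \<open>Keeping the formula in the form \<open>sub_fm \<sigma> \<tau>\<close> avoids lifting the
  chosen terms: each elimination merely puts one more value at the front of the substitution and
  moves the old values up by one index.\<close>

lemma ded_AllN_instances:
  assumes "ded L T \<Gamma> (sub_fm \<sigma> \<tau> ((AllN ^^ k) A))" "\<And>i. wf_trm L (s i)"
  shows "ded L T \<Gamma> (sub_fm (\<lambda>i. if i < k then s i else \<sigma> (i - k)) \<tau> A)"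
  using assms
proof (induction k arbitrary: A s)
  case (Suc k)
  \<comment> \<open>The outer \<open>k\<close> quantifiers receive \<open>s 1\<close>, ...,
    \<open>s k\<close>; the innermost one, which binds index 0, is left for
    \<open>s 0\<close>.\<close>
  have "ded L T \<Gamma> (sub_fm (\<lambda>i. if i < k then s (Suc i) else \<sigma> (i - k)) \<tau> (AllN A))"
    using Suc.prems by (intro Suc.IH) (simp_all add: funpow_swap1)
  from ded.AllNE[OF this[simplified], of "s 0"] Suc.prems(2)
  have "ded L T \<Gamma> (sub_fm (case_nat (s 0) (\<lambda>i. if i < k then s (Suc i) else \<sigma> (i - k))) \<tau> A)"
    by (simp add: instN_sub_upN)
  moreover have "case_nat (s 0) (\<lambda>i. if i < k then s (Suc i) else \<sigma> (i - k)) =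
      (\<lambda>i. if i < Suc k then s i else \<sigma> (i - Suc k))"
    by (auto simp: fun_eq_iff split: nat.split)
  ultimately show ?case by simp
qed simp

lemma ded_AllF_instances:
  assumes "ded L T \<Gamma> (sub_fm \<sigma> \<tau> ((AllF ^^ k) A))" "\<And>i. wf_fnc L (u i)"
  shows "ded L T \<Gamma> (sub_fm \<sigma> (\<lambda>i. if i < k then u i else \<tau> (i - k)) A)"
  using assms
proof (induction k arbitrary: A u)
  case (Suc k)
  have "ded L T \<Gamma> (sub_fm \<sigma> (\<lambda>i. if i < k then u (Suc i) else \<tau> (i - k)) (AllF A))"
    using Suc.prems by (intro Suc.IH) (simp_all add: funpow_swap1)
  from ded.AllFE[OF this[simplified], of "u 0"] Suc.prems(2)
  have "ded L T \<Gamma> (sub_fm \<sigma> (case_nat (u 0) (\<lambda>i. if i < k then u (Suc i) else \<tau> (i - k))) A)"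
    by (simp add: instF_sub_upF)
  moreover have "case_nat (u 0) (\<lambda>i. if i < k then u (Suc i) else \<tau> (i - k)) =
      (\<lambda>i. if i < Suc k then u i else \<tau> (i - Suc k))"
    by (auto simp: fun_eq_iff split: nat.split)
  ultimately show ?case by simp
qed simp

text \<open>The axiom set itself need not be closed under substitution: quantify all free variables
  of the axiom and instantiate.\<close>

lemma ded_sub_closed:
  assumes "ded L T [] A" "wf_sub L \<sigma> \<tau>"
  shows "ded L T \<Gamma> (sub_fm \<sigma> \<tau> A)"
proof -
  obtain m where m: "\<And>\<sigma> \<sigma>' \<tau> \<tau>'. agree m \<sigma> \<sigma>' \<Longrightarrow> agree m \<tau> \<tau>' \<Longrightarrow>
    sub_fm \<sigma> \<tau> A = sub_fm \<sigma>' \<tau>' A" using finite_support_fm by metis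
  have F: "ded L T [] ((AllF ^^ k) A)" for k
    by (induction k) (auto intro: assms ded.AllFI)
  have "ded L T [] ((AllN ^^ k) ((AllF ^^ m) A))" for k
    by (induction k) (auto intro: F ded.AllNI)
  \<comment> \<open>The identity substitution brings the generalized formula into the form which the
    two elimination lemmas expect.\<close>
  then have "ded L T [] (sub_fm NVar FVar ((AllN ^^ m) ((AllF ^^ m) A)))" by simp
  from ded_AllF_instances[OF ded_AllN_instances[OF this], of \<sigma> \<tau>] assms(2)
  have "ded L T [] (sub_fm (\<lambda>i. if i < m then \<sigma> i else NVar (i - m))
      (\<lambda>i. if i < m then \<tau> i else FVar (i - m)) A)"
    by (auto simp: wf_sub_def)
  \<comment> \<open>From index \<open>m\<close> on the two substitutions may differ, but
    \<open>A\<close> does not depend on those values.\<close>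
  also have "sub_fm (\<lambda>i. if i < m then \<sigma> i else NVar (i - m))
      (\<lambda>i. if i < m then \<tau> i else FVar (i - m)) A = sub_fm \<sigma> \<tau> A"
    by (rule m) (auto simp: agree_def)
  finally show ?thesis by (rule ded_weaken) simp
qed

lemma map_sub_lift:
  "map (sub_fm (upN_trm \<sigma>) (upN_fnc \<tau>)) (map liftN \<Gamma>) = map liftN (map (sub_fm \<sigma> \<tau>) \<Gamma>)"
  "map (sub_fm (upF_trm \<sigma>) (upF_fnc \<tau>)) (map liftF \<Gamma>) = map liftF (map (sub_fm \<sigma> \<tau>) \<Gamma>)"
  by (simp_all add: sub_liftN sub_liftF)

text \<open>The rules commute with substitution by the lifting laws; the exception is an axiom,
  whose instance need not be an axiom. There \<open>ded_sub_closed\<close> generalizes and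
  specialises instead.\<close>

lemma ded_sub:
  "ded L T \<Gamma> A \<Longrightarrow> wf_sub L \<sigma> \<tau> \<Longrightarrow> ded L T (map (sub_fm \<sigma> \<tau>) \<Gamma>) (sub_fm \<sigma> \<tau> A)"
proof (induction arbitrary: \<sigma> \<tau> rule: ded.induct)
  case (Axiom A \<Gamma>)
  then show ?case by (intro ded_sub_closed ded.Axiom)
next
  case (Assm A \<Gamma>)
  then show ?case by (intro ded.Assm) auto
next
  case (ImpI A \<Gamma> B)
  then show ?case by (auto intro!: ded.ImpI wf_sub_fm)
next
  case (OrE \<Gamma> A B C)
  show ?case
    by (rule ded.OrE[of _ _ _ "sub_fm \<sigma> \<tau> A" "sub_fm \<sigma> \<tau> B"])
       (use OrE.IH[OF OrE.prems] in simp_all)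
next
  case (NegI A \<Gamma> B)
  show ?case using NegI.IH[OF NegI.prems] NegI.hyps NegI.prems
    by (auto intro!: ded.NegI[of _ _ _ _ "sub_fm \<sigma> \<tau> B"] wf_sub_fm)
next
  case (AllNI \<Gamma> A)
  have "ded L T (map liftN (map (sub_fm \<sigma> \<tau>) \<Gamma>)) (sub_fm (upN_trm \<sigma>) (upN_fnc \<tau>) A)"
    using AllNI.IH[of "upN_trm \<sigma>" "upN_fnc \<tau>"] AllNI.prems unfolding map_sub_lift by simp
  then show ?case by (simp add: ded.AllNI)
next
  case (AllFI \<Gamma> A)
  have "ded L T (map liftF (map (sub_fm \<sigma> \<tau>) \<Gamma>)) (sub_fm (upF_trm \<sigma>) (upF_fnc \<tau>) A)"
    using AllFI.IH[of "upF_trm \<sigma>" "upF_fnc \<tau>"] AllFI.prems unfolding map_sub_lift by simp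
  then show ?case by (simp add: ded.AllFI)
next
  case (AllNE \<Gamma> A t)
  then show ?case by (simp add: sub_instN ded.AllNE wf_sub_trm)
next
  case (AllFE \<Gamma> A t)
  then show ?case by (simp add: sub_instF ded.AllFE wf_sub_fnc)
next
  case (ExNI A t \<Gamma>)
  then show ?case by (auto simp: sub_instN intro!: ded.ExNI[of _ _ "sub_trm \<sigma> \<tau> t"] wf_sub_trm wf_sub_fm)
next
  case (ExFI A u \<Gamma>)
  then show ?case by (auto simp: sub_instF intro!: ded.ExFI[of _ _ "sub_fnc \<sigma> \<tau> u"] wf_sub_fnc wf_sub_fm)
next
  case (ExNE \<Gamma> A B)
  show ?case
    by (rule ded.ExNE[of _ _ _ "sub_fm (upN_trm \<sigma>) (upN_fnc \<tau>) A"])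
       (use ExNE.IH(1)[of \<sigma> \<tau>] ExNE.IH(2)[of "upN_trm \<sigma>" "upN_fnc \<tau>"] ExNE.prems in
        \<open>simp_all add: sub_liftN comp_def\<close>)
next
  case (ExFE \<Gamma> A B)
  show ?case
    by (rule ded.ExFE[of _ _ _ "sub_fm (upF_trm \<sigma>) (upF_fnc \<tau>) A"])
       (use ExFE.IH(1)[of \<sigma> \<tau>] ExFE.IH(2)[of "upF_trm \<sigma>" "upF_fnc \<tau>"] ExFE.prems in
        \<open>simp_all add: sub_liftF comp_def\<close>)
next
  case (OrI1 \<Gamma> A B)
  then show ?case by (simp add: ded.OrI1 wf_sub_fm)
next
  case (OrI2 \<Gamma> A B)
  then show ?case by (simp add: ded.OrI2 wf_sub_fm)
next
  case (NegE \<Gamma> A B)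
  show ?case by (rule ded.NegE[of _ _ _ "sub_fm \<sigma> \<tau> A"]) (use NegE in \<open>simp_all add: wf_sub_fm\<close>)
next
  case (ImpE \<Gamma> A B)
  show ?case by (rule ded.ImpE[of _ _ _ "sub_fm \<sigma> \<tau> A"]) (use ImpE in simp_all)
next
  case (AndI \<Gamma> A B)
  then show ?case by (simp add: ded.AndI)
next
  case (AndE1 \<Gamma> A B)
  show ?case by (rule ded.AndE1[of _ _ _ _ "sub_fm \<sigma> \<tau> B"]) (use AndE1 in simp)
next
  case (AndE2 \<Gamma> A B)
  show ?case by (rule ded.AndE2[of _ _ _ "sub_fm \<sigma> \<tau> A"]) (use AndE2 in simp)
qed

section \<open>Opening quantifiers and specialising theorems to terms\<close>

abbreviation "v0 \<equiv> NVar 0"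
abbreviation "v1 \<equiv> NVar (Suc 0)"
abbreviation "v2 \<equiv> NVar (Suc (Suc 0))"

abbreviation liftT :: "'c trm \<Rightarrow> 'c trm" where "liftT \<equiv> ren_trm Suc id"

lemma sub_lift [simp]:
  "sub_trm (case_nat s \<sigma>) \<tau> (liftT t) = sub_trm \<sigma> \<tau> t"
  "sub_trm (upN_trm \<sigma>) (upN_fnc \<tau>) (liftT t) = liftT (sub_trm \<sigma> \<tau> t)"
  "sub_fnc (case_nat s \<sigma>) \<tau> (ren_fnc Suc id u) = sub_fnc \<sigma> \<tau> u"
  "sub_fnc (upN_trm \<sigma>) (upN_fnc \<tau>) (ren_fnc Suc id u) = ren_fnc Suc id (sub_fnc \<sigma> \<tau> u)"
  by (simp_all add: sub_ren_trm sub_ren_fnc ren_sub_trm ren_sub_fnc upN_fnc_def)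

lemma sub_lift_FVar [simp]:
  "sub_trm (upN_trm \<sigma>) FVar (liftT t) = liftT (sub_trm \<sigma> FVar t)"
  "sub_fnc (upN_trm \<sigma>) FVar (ren_fnc Suc id u) = ren_fnc Suc id (sub_fnc \<sigma> FVar u)"
  by (simp_all add: sub_ren_trm sub_ren_fnc ren_sub_trm ren_sub_fnc)

lemma sub_Suc [simp]:
  "sub_trm (\<lambda>n. NVar (Suc n)) FVar t = liftT t"
  by (simp_all add: ren_trm_eq_sub ren_fnc_eq_sub)

lemma ren_lift [simp]:
  "ren_trm (up r) q (liftT t) = liftT (ren_trm r q t)"
  by (simp_all add: ren_ren_trm ren_ren_fnc)

lemma ded_weaken_Cons: "ded L T \<Gamma> A \<Longrightarrow> ded L T (B # \<Gamma>) A"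
  by (erule ded_weaken) auto

lemma ded_liftN: "ded L T \<Gamma> A \<Longrightarrow> ded L T (map liftN \<Gamma>) (liftN A)"
  using ded_sub[of L T \<Gamma> A "\<lambda>n. NVar (Suc n)" FVar]
  by (simp add: wf_sub_def ren_fm_eq_sub[abs_def])

lemma ded_liftF: "ded L T \<Gamma> A \<Longrightarrow> ded L T (map liftF \<Gamma>) (liftF A)"
  using ded_sub[of L T \<Gamma> A NVar "\<lambda>n. FVar (Suc n)"]
  by (simp add: wf_sub_def ren_fm_eq_sub[abs_def])

text \<open>Shifting a quantified formula under its binder and then choosing the fresh variable as
  the instance restores the body. This is how \<open>ded_AllN_open\<close> strips a universal
  quantifier.\<close>

lemma instN_lift_body [simp]: "instN (ren_fm (up Suc) id A) v0 = A"
proof -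
  have "instN (ren_fm (up Suc) id A) v0 = sub_fm NVar FVar A"
    unfolding to_sub by (rule sub_fm_cong) (auto simp: up_def split: nat.split)
  then show ?thesis by simp
qed

lemma instF_lift_body [simp]: "instF (ren_fm id (up Suc) A) (FVar 0) = A"
proof -
  have "instF (ren_fm id (up Suc) A) (FVar 0) = sub_fm NVar FVar A"
    unfolding to_sub by (rule sub_fm_cong) (auto simp: up_def split: nat.split)
  then show ?thesis by simp
qed

lemma ded_AllN_open: "ded L T \<Gamma> (AllN A) \<Longrightarrow> ded L T (map liftN \<Gamma>) A"
  using ded.AllNE[of L T "map liftN \<Gamma>" "ren_fm (up Suc) id A" v0] ded_liftN[of L T \<Gamma> "AllN A"]
  by simp

lemma ded_AllF_open: "ded L T \<Gamma> (AllF A) \<Longrightarrow> ded L T (map liftF \<Gamma>) A"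
  using ded.AllFE[of L T "map liftF \<Gamma>" "ren_fm id (up Suc) A" "FVar 0"] ded_liftF[of L T \<Gamma> "AllF A"]
  by simp

lemma ded_open: "ded L T [] (AllN A) \<Longrightarrow> ded L T [] A"
  using ded_AllN_open[of L T "[]"] by simp

lemma ded_inst:
  "ded L T [] A \<Longrightarrow> (\<And>n. wf_trm L (\<sigma> n)) \<Longrightarrow> ded L T \<Gamma> (sub_fm \<sigma> FVar A)"
  by (rule ded_sub_closed) (simp_all add: wf_sub_def)

lemma ded_inst2:
  "ded L T [] A \<Longrightarrow> wf_trm L s \<Longrightarrow> wf_trm L t \<Longrightarrow> ded L T \<Gamma> (sub_fm (case_nat s (\<lambda>_. t)) FVar A)"
  by (rule ded_inst) (auto split: nat.split)

text \<open>Replacement for arbitrary terms under arbitrary assumptions is the interface to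
  equality. It is earned differently: from conversion in IA1, from a schema about variables in
  HA1.\<close>

locale equality_logic =
  fixes L :: "'c lang" and T :: "'c fm set"
  assumes refl_axiom: "ded L T [] (v0 \<doteq> v0)"
    and replacement: "wf_fm L A \<Longrightarrow> wf_trm L s \<Longrightarrow> wf_trm L t \<Longrightarrow> ded L T \<Gamma> (s \<doteq> t) \<Longrightarrow>
      ded L T \<Gamma> (instN A s) \<Longrightarrow> ded L T \<Gamma> (instN A t)"
begin

abbreviation derivable (infix "\<turnstile>" 40) where "\<Gamma> \<turnstile> A \<equiv> ded L T \<Gamma> A"

lemma eq_refl: "wf_trm L t \<Longrightarrow> \<Gamma> \<turnstile> t \<doteq> t"
  using ded_inst[OF refl_axiom, of "\<lambda>_. t"] by simp

lemma eq_sym: "\<Gamma> \<turnstile> s \<doteq> t \<Longrightarrow> wf_trm L s \<Longrightarrow> wf_trm L t \<Longrightarrow> \<Gamma> \<turnstile> t \<doteq> s"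
  using replacement[of "v0 \<doteq> liftT s" s t \<Gamma>] by (simp add: instN_def eq_refl)

lemma eq_trans:
  "\<Gamma> \<turnstile> s \<doteq> t \<Longrightarrow> \<Gamma> \<turnstile> t \<doteq> r \<Longrightarrow> wf_trm L s \<Longrightarrow> wf_trm L t \<Longrightarrow> wf_trm L r \<Longrightarrow> \<Gamma> \<turnstile> s \<doteq> r"
  using replacement[of "liftT s \<doteq> v0" t r \<Gamma>] by (simp add: instN_def)

lemma eq_cong:
  "\<Gamma> \<turnstile> s \<doteq> t \<Longrightarrow> wf_trm L r \<Longrightarrow> wf_trm L s \<Longrightarrow> wf_trm L t \<Longrightarrow> \<Gamma> \<turnstile> instT r s \<doteq> instT r t"
  \<comment> \<open>The left side is lifted so that the instantiation reaches only the right one,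
    and reflexivity provides the starting instance.\<close>
  using replacement[of "liftT (instT r s) \<doteq> r" s t \<Gamma>]
    eq_refl[of "instT r s"] wf_sub_trm[of L r "case_nat s NVar" FVar]
  by (simp add: instN_def instT_def wf_sub_def split: nat.split)

end

text \<open>Addition and triangular numbers are operations on terms, not constants, because the
  systems realise them differently: in IA1 the triangular number is a sum over a lambda term, in HA1
  addition is a constant with its arguments swapped. Commuting with substitution is what lets their
  equations be specialised without unfolding.\<close>

locale choice_arithmetic = equality_logic L T for L :: "'c lang" and T +
  fixes plus :: "'c trm \<Rightarrow> 'c trm \<Rightarrow> 'c trm" (infixl "\<oplus>" 65) and tri :: "'c trm \<Rightarrow> 'c trm"
  assumes sub_plus [simp]: "sub_trm \<sigma> \<tau> (s \<oplus> t) = sub_trm \<sigma> \<tau> s \<oplus> sub_trm \<sigma> \<tau> t"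
    and sub_tri [simp]: "sub_trm \<sigma> \<tau> (tri s) = tri (sub_trm \<sigma> \<tau> s)"
    and wf_plus [simp]: "wf_trm L (s \<oplus> t) \<longleftrightarrow> wf_trm L s \<and> wf_trm L t"
    and wf_tri [simp]: "wf_trm L (tri s) \<longleftrightarrow> wf_trm L s"
    and const_arity: "arity L (zeroC L) = Some (0, 0)" "arity L (sucC L) = Some (1, 0)"
      "arity L (plusC L) = Some (2, 0)"
    and suc_neq_axiom: "ded L T [] (\<^bold>\<not> (Succ L v0 \<doteq> Zero L))"
    and suc_inj_axiom: "ded L T [] (Succ L v0 \<doteq> Succ L v1 \<^bold>\<longrightarrow> v0 \<doteq> v1)"
    and plus_zero_axiom: "ded L T [] (v0 \<oplus> Zero L \<doteq> v0)"
    and plus_suc_axiom: "ded L T [] (v0 \<oplus> Succ L v1 \<doteq> Succ L (v0 \<oplus> v1))"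
    and tri_zero_axiom: "ded L T [] (tri (Zero L) \<doteq> Zero L)"
    and tri_suc_axiom: "ded L T [] (tri (Succ L v0) \<doteq> Succ L (tri v0 \<oplus> v0))"
    and schemata: "induction_schema L \<subseteq> T" "QF_AC00 L \<subseteq> T" "CF_d L \<subseteq> T"
begin

section \<open>Elementary arithmetic inside the theory\<close>

abbreviation Z where "Z \<equiv> Zero L"
abbreviation S where "S \<equiv> Succ L"

lemma wf_Z [simp]: "wf_trm L Z" and wf_S [simp]: "wf_trm L (S t) \<longleftrightarrow> wf_trm L t"
  by (simp_all add: Zero_def Succ_def const_arity)

lemma sub_Z [simp]: "sub_trm \<sigma> \<tau> Z = Z" and sub_S [simp]: "sub_trm \<sigma> \<tau> (S t) = S (sub_trm \<sigma> \<tau> t)"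
  by (simp_all add: Zero_def Succ_def)

lemma ren_arith [simp]:
  "ren_trm r q Z = Z" "ren_trm r q (S t) = S (ren_trm r q t)"
  "ren_trm r q (s \<oplus> t) = ren_trm r q s \<oplus> ren_trm r q t" "ren_trm r q (tri s) = tri (ren_trm r q s)"
  by (simp_all add: ren_trm_eq_sub)

lemma suc_neq: "\<Gamma> \<turnstile> S t \<doteq> Z \<Longrightarrow> wf_trm L t \<Longrightarrow> wf_fm L B \<Longrightarrow> \<Gamma> \<turnstile> B"
  using ded_inst[OF suc_neq_axiom, of "\<lambda>_. t"] by (auto intro: ded.NegE)

lemma suc_neq': "\<Gamma> \<turnstile> Z \<doteq> S t \<Longrightarrow> wf_trm L t \<Longrightarrow> wf_fm L B \<Longrightarrow> \<Gamma> \<turnstile> B"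
  by (rule suc_neq[OF eq_sym]) auto

lemma suc_inj: "\<Gamma> \<turnstile> S s \<doteq> S t \<Longrightarrow> wf_trm L s \<Longrightarrow> wf_trm L t \<Longrightarrow> \<Gamma> \<turnstile> s \<doteq> t"
  using ded_inst2[OF suc_inj_axiom, of s t]
  by (auto intro: ded.ImpE split: nat.splits)

lemma suc_cong: "\<Gamma> \<turnstile> s \<doteq> t \<Longrightarrow> wf_trm L s \<Longrightarrow> wf_trm L t \<Longrightarrow> \<Gamma> \<turnstile> S s \<doteq> S t"
  using eq_cong[of \<Gamma> s t "S v0"] by (simp add: instT_def)

lemma tri_cong: "\<Gamma> \<turnstile> s \<doteq> t \<Longrightarrow> wf_trm L s \<Longrightarrow> wf_trm L t \<Longrightarrow> \<Gamma> \<turnstile> tri s \<doteq> tri t"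
  using eq_cong[of \<Gamma> s t "tri v0"] by (simp add: instT_def)

lemma plus_cong1: "\<Gamma> \<turnstile> s \<doteq> t \<Longrightarrow> wf_trm L r \<Longrightarrow> wf_trm L s \<Longrightarrow> wf_trm L t \<Longrightarrow> \<Gamma> \<turnstile> s \<oplus> r \<doteq> t \<oplus> r"
  using eq_cong[of \<Gamma> s t "v0 \<oplus> liftT r"] by (simp add: instT_def)

lemma plus_zero: "wf_trm L t \<Longrightarrow> \<Gamma> \<turnstile> t \<oplus> Z \<doteq> t"
  using ded_inst[OF plus_zero_axiom, of "\<lambda>_. t"] by simp

lemma plus_suc: "wf_trm L s \<Longrightarrow> wf_trm L t \<Longrightarrow> \<Gamma> \<turnstile> s \<oplus> S t \<doteq> S (s \<oplus> t)"
  using ded_inst2[OF plus_suc_axiom, of s t] by (simp split: nat.splits)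

lemma tri_zero: "\<Gamma> \<turnstile> tri Z \<doteq> Z"
  using ded_inst[OF tri_zero_axiom, of NVar] by simp

lemma tri_suc: "wf_trm L t \<Longrightarrow> \<Gamma> \<turnstile> tri (S t) \<doteq> S (tri t \<oplus> t)"
  using ded_inst[OF tri_suc_axiom, of "\<lambda>_. t"] by simp

text \<open>An explosive assumption proves both \<open>Z \<doteq> Z\<close> and its negation, the
  contradictory pair demanded by the negation rule.\<close>

lemma neg_of_explosive: "(\<And>B. wf_fm L B \<Longrightarrow> A # \<Gamma> \<turnstile> B) \<Longrightarrow> wf_fm L A \<Longrightarrow> \<Gamma> \<turnstile> \<^bold>\<not> A"
  by (rule ded.NegI[of _ _ _ _ "Z \<doteq> Z"]) simp_all

lemma nat_induct_rule:
  assumes "wf_fm L P" "\<Gamma> \<turnstile> instN P Z"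
    and "P # map liftN \<Gamma> \<turnstile> sub_fm (case_nat (S v0) (\<lambda>n. NVar (Suc n))) FVar P"
  shows "\<Gamma> \<turnstile> AllN P"
proof -
  have "\<Gamma> \<turnstile> instN P Z \<^bold>\<and> AllN (P \<^bold>\<longrightarrow> sub_fm (case_nat (S v0) (\<lambda>n. NVar (Suc n))) FVar P) \<^bold>\<longrightarrow> AllN P"
    using schemata(1) assms(1) by (intro ded.Axiom) (auto simp: induction_schema_def)
  then show ?thesis
    by (rule ded.ImpE) (intro ded.AndI ded.AllNI ded.ImpI assms)
qed

text \<open>The distinction between zero and successor, obtained from induction by
  weakening.\<close>

lemma nat_cases_rule:
  assumes "wf_fm L P" "\<Gamma> \<turnstile> instN P Z"
    and "map liftN \<Gamma> \<turnstile> sub_fm (case_nat (S v0) (\<lambda>n. NVar (Suc n))) FVar P"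
  shows "\<Gamma> \<turnstile> AllN P"
  using assms by (intro nat_induct_rule ded_weaken_Cons)

lemma zero_plus: "wf_trm L t \<Longrightarrow> \<Gamma> \<turnstile> Z \<oplus> t \<doteq> t"
proof -
  have "[] \<turnstile> AllN (Z \<oplus> v0 \<doteq> v0)"
  proof (rule nat_induct_rule)
    show "[] \<turnstile> instN (Z \<oplus> v0 \<doteq> v0) Z" by (simp add: instN_def plus_zero)
    have "[Z \<oplus> v0 \<doteq> v0] \<turnstile> Z \<oplus> S v0 \<doteq> S v0"
      by (rule eq_trans[OF plus_suc suc_cong]) (auto intro: ded.Assm)
    then show "(Z \<oplus> v0 \<doteq> v0) # map liftN [] \<turnstile>
        sub_fm (case_nat (S v0) (\<lambda>n. NVar (Suc n))) FVar (Z \<oplus> v0 \<doteq> v0)" by simp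
  qed simp
  from ded_inst[OF ded_open[OF this], of "\<lambda>_. t"] show "wf_trm L t \<Longrightarrow> ?thesis" by simp
qed

text \<open>Addition recurses on its right argument, so this takes an induction. Carrying a
  successor from one summand to the other is what keeps a pair on its diagonal.\<close>

lemma suc_plus: "wf_trm L s \<Longrightarrow> wf_trm L t \<Longrightarrow> \<Gamma> \<turnstile> S s \<oplus> t \<doteq> s \<oplus> S t"
proof -
  let ?P = "S v1 \<oplus> v0 \<doteq> v1 \<oplus> S v0"
  have "[] \<turnstile> AllN ?P"
  proof (rule nat_induct_rule)
    have "[] \<turnstile> S v0 \<oplus> Z \<doteq> v0 \<oplus> S Z"
      by (rule eq_trans[OF plus_zero eq_sym[OF eq_trans[OF plus_suc suc_cong[OF plus_zero]]]]) simp_all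
    then show "[] \<turnstile> instN ?P Z" by (simp add: instN_def)
    have "[?P] \<turnstile> S v1 \<oplus> S v0 \<doteq> v1 \<oplus> S (S v0)"
      by (rule eq_trans[OF plus_suc eq_trans[OF suc_cong eq_sym[OF plus_suc]]])
         (auto intro: ded.Assm)
    then show "?P # map liftN [] \<turnstile> sub_fm (case_nat (S v0) (\<lambda>n. NVar (Suc n))) FVar ?P" by simp
  qed simp
  from ded_inst2[OF ded_open[OF this], of t s]
  show "wf_trm L s \<Longrightarrow> wf_trm L t \<Longrightarrow> ?thesis" by (simp split: nat.splits)
qed

text \<open>Zero differs from every successor, and two successors are compared through their
  predecessors.\<close>

lemma eq_decidable: "wf_trm L s \<Longrightarrow> wf_trm L t \<Longrightarrow> \<Gamma> \<turnstile> s \<doteq> t \<^bold>\<or> \<^bold>\<not> (s \<doteq> t)"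
proof -
  let ?D = "\<lambda>s t. s \<doteq> t \<^bold>\<or> \<^bold>\<not> (s \<doteq> t)"
  have "[] \<turnstile> AllN (AllN (?D v1 v0))"
  \<comment> \<open>The second number stays universally quantified in the induction hypothesis,
    which is later needed at that number's predecessor.\<close>
  proof (rule nat_induct_rule)
    have "[] \<turnstile> AllN (?D Z v0)"
    proof (rule nat_cases_rule)
      have "[] \<turnstile> ?D Z Z" by (intro ded.OrI1 eq_refl) auto
      then show "[] \<turnstile> instN (?D Z v0) Z" by (simp add: instN_def)
      have "[Z \<doteq> S v0] \<turnstile> B" if "wf_fm L B" for B
        by (rule suc_neq'[OF ded.Assm, of v0]) (simp_all add: that)
      then have "[] \<turnstile> ?D Z (S v0)"
        by (metis ded.OrI2 neg_of_explosive wf_Z wf_S wf_fm.simps(1) wf_trm.simps(1))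
      then show "map liftN [] \<turnstile> sub_fm (case_nat (S v0) (\<lambda>n. NVar (Suc n))) FVar (?D Z v0)" by simp
    qed simp
    then show "[] \<turnstile> instN (AllN (?D v1 v0)) Z" by (simp add: instN_def)
    have "[AllN (?D v1 v0)] \<turnstile> AllN (?D (S v1) v0)"
    proof (rule nat_cases_rule)
      have "[S v0 \<doteq> Z, AllN (?D v1 v0)] \<turnstile> B" if "wf_fm L B" for B
        by (rule suc_neq[OF ded.Assm, of v0]) (simp_all add: that)
      then have "[AllN (?D v1 v0)] \<turnstile> ?D (S v0) Z"
        by (metis ded.OrI2 neg_of_explosive wf_Z wf_S wf_fm.simps(1) wf_trm.simps(1))
      then show "[AllN (?D v1 v0)] \<turnstile> instN (?D (S v1) v0) Z" by (simp add: instN_def)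
      let ?\<Gamma> = "[AllN (?D v2 v0)]"
      have "?\<Gamma> \<turnstile> ?D (S v1) (S v0)"
      proof (rule ded.OrE)
        have "?\<Gamma> \<turnstile> AllN (?D v2 v0)" by (simp add: ded.Assm)
        from ded.AllNE[OF this, of v0] show "?\<Gamma> \<turnstile> ?D v1 v0" by (simp add: instN_def)
        have "(v1 \<doteq> v0) # ?\<Gamma> \<turnstile> S v1 \<doteq> S v0" by (intro suc_cong ded.Assm) simp_all
        then show "(v1 \<doteq> v0) # ?\<Gamma> \<turnstile> ?D (S v1) (S v0)" by (intro ded.OrI1) simp_all
        have "(S v1 \<doteq> S v0) # (\<^bold>\<not> (v1 \<doteq> v0)) # ?\<Gamma> \<turnstile> v1 \<doteq> v0" by (rule suc_inj[OF ded.Assm]) simp_all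
        moreover have "(S v1 \<doteq> S v0) # (\<^bold>\<not> (v1 \<doteq> v0)) # ?\<Gamma> \<turnstile> \<^bold>\<not> (v1 \<doteq> v0)" by (intro ded.Assm) simp
        ultimately have "(\<^bold>\<not> (v1 \<doteq> v0)) # ?\<Gamma> \<turnstile> \<^bold>\<not> (S v1 \<doteq> S v0)" by (rule ded.NegI[rotated]) simp
        then show "(\<^bold>\<not> (v1 \<doteq> v0)) # ?\<Gamma> \<turnstile> ?D (S v1) (S v0)" by (intro ded.OrI2) simp_all
      qed
      then show "map liftN [AllN (?D v1 v0)] \<turnstile>
          sub_fm (case_nat (S v0) (\<lambda>n. NVar (Suc n))) FVar (?D (S v1) v0)" by simp
    qed simp
    then show "AllN (?D v1 v0) # map liftN [] \<turnstile>
        sub_fm (case_nat (S v0) (\<lambda>n. NVar (Suc n))) FVar (AllN (?D v1 v0))" by simp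
  qed simp
  from ded_inst2[OF ded_open[OF ded_open[OF this]], of t s]
  show "wf_trm L s \<Longrightarrow> wf_trm L t \<Longrightarrow> ?thesis" by (simp split: nat.splits)
qed

section \<open>Cantor's pairing function\<close>

definition pair :: "'c trm \<Rightarrow> 'c trm \<Rightarrow> 'c trm" where "pair s t = tri (s \<oplus> t) \<oplus> s"

lemma wf_pair [simp]: "wf_trm L (pair s t) \<longleftrightarrow> wf_trm L s \<and> wf_trm L t"
  by (auto simp: pair_def)

lemma sub_pair [simp]:
  "sub_trm \<sigma> \<tau> (pair s t) = pair (sub_trm \<sigma> \<tau> s) (sub_trm \<sigma> \<tau> t)"
  "ren_trm r q (pair s t) = pair (ren_trm r q s) (ren_trm r q t)"
  by (simp_all add: pair_def)

lemma pair_zero_zero: "\<Gamma> \<turnstile> pair Z Z \<doteq> Z"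
  unfolding pair_def
  by (rule eq_trans[OF plus_zero eq_trans[OF tri_cong[OF plus_zero] tri_zero]]) simp_all

text \<open>By \<open>suc_plus\<close> both pairs have the same sum, hence the same triangular part;
  the remaining summand is larger by one.\<close>

lemma pair_suc: "wf_trm L s \<Longrightarrow> wf_trm L t \<Longrightarrow> \<Gamma> \<turnstile> pair (S s) t \<doteq> S (pair s (S t))"
  unfolding pair_def
  by (rule eq_trans[OF plus_suc suc_cong[OF plus_cong1[OF tri_cong[OF suc_plus]]]]) simp_all

text \<open>A diagonal begins at \<open>tri (S t)\<close>, one above
  \<open>tri t \<oplus> t\<close>, the code that ends the diagonal before it.\<close>

lemma pair_zero_suc:
  assumes [simp]: "wf_trm L t"
  shows "\<Gamma> \<turnstile> pair Z (S t) \<doteq> S (pair t Z)"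
proof -
  have 1: "\<Gamma> \<turnstile> pair Z (S t) \<doteq> tri (S t)" unfolding pair_def
    by (rule eq_trans[OF plus_zero tri_cong[OF zero_plus]]) simp_all
  have 2: "\<Gamma> \<turnstile> S (pair t Z) \<doteq> S (tri t \<oplus> t)" unfolding pair_def
    by (rule suc_cong[OF plus_cong1[OF tri_cong[OF plus_zero]]]) simp_all
  show ?thesis
    by (rule eq_trans[OF 1 eq_trans[OF tri_suc eq_sym[OF 2]]]) simp_all
qed

text \<open>This and the next four facts invert the recursion for codes. A pair of one of the shapes
  \<open>(0,0)\<close>, \<open>(0,t')\<close>, \<open>(s',t)\<close> is confronted with code 0 or
  with a successor, giving a contradiction or the preceding pair.\<close>

lemma pair_suc_neq: "\<Gamma> \<turnstile> pair (S s) t \<doteq> Z \<Longrightarrow> wf_trm L s \<Longrightarrow> wf_trm L t \<Longrightarrow> wf_fm L B \<Longrightarrow> \<Gamma> \<turnstile> B"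
  by (rule suc_neq[OF eq_trans[OF eq_sym[OF pair_suc[of s t]]]]) simp_all

lemma pair_zero_suc_neq: "\<Gamma> \<turnstile> pair Z (S t) \<doteq> Z \<Longrightarrow> wf_trm L t \<Longrightarrow> wf_fm L B \<Longrightarrow> \<Gamma> \<turnstile> B"
  by (rule suc_neq[OF eq_trans[OF eq_sym[OF pair_zero_suc[of t]]]]) simp_all

lemma pair_zero_zero_neq: "\<Gamma> \<turnstile> pair Z Z \<doteq> S z \<Longrightarrow> wf_trm L z \<Longrightarrow> wf_fm L B \<Longrightarrow> \<Gamma> \<turnstile> B"
  by (rule suc_neq'[OF eq_trans[OF eq_sym[OF pair_zero_zero]]]) simp_all

lemma pair_suc_eq_suc: "\<Gamma> \<turnstile> pair (S s) t \<doteq> S z \<Longrightarrow> wf_trm L s \<Longrightarrow> wf_trm L t \<Longrightarrow> wf_trm L z \<Longrightarrow>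
    \<Gamma> \<turnstile> pair s (S t) \<doteq> z"
  by (rule suc_inj[OF eq_trans[OF eq_sym[OF pair_suc[of s t]]]]) simp_all

lemma pair_zero_suc_eq_suc: "\<Gamma> \<turnstile> pair Z (S t) \<doteq> S z \<Longrightarrow> wf_trm L t \<Longrightarrow> wf_trm L z \<Longrightarrow>
    \<Gamma> \<turnstile> pair t Z \<doteq> z"
  by (rule suc_inj[OF eq_trans[OF eq_sym[OF pair_zero_suc[of t]]]]) simp_all

section \<open>Existence and uniqueness of decoding\<close>

definition unique_code :: "'c trm \<Rightarrow> 'c trm \<Rightarrow> 'c trm \<Rightarrow> 'c fm" where
  "unique_code x y z = AllN (AllN (pair v1 v0 \<doteq> liftT (liftT z) \<^bold>\<longrightarrow>
     v1 \<doteq> liftT (liftT x) \<^bold>\<and> v0 \<doteq> liftT (liftT y)))"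

text \<open>The existential part is surjectivity, \<open>unique_code\<close> is injectivity at the
  code \<open>z\<close>. They travel together since both the next pair and its uniqueness are
  obtained from the pair just found.\<close>

definition uniquely_coded :: "'c trm \<Rightarrow> 'c fm" where
  "uniquely_coded z = ExN (ExN (pair v1 v0 \<doteq> liftT (liftT z) \<^bold>\<and> unique_code v1 v0 (liftT (liftT z))))"

lemma wf_unique_code [simp]: "wf_trm L x \<Longrightarrow> wf_trm L y \<Longrightarrow> wf_trm L z \<Longrightarrow> wf_fm L (unique_code x y z)"
  by (simp add: unique_code_def)

lemma sub_unique_code [simp]:
  "sub_fm \<sigma> \<tau> (unique_code x y z) = unique_code (sub_trm \<sigma> \<tau> x) (sub_trm \<sigma> \<tau> y) (sub_trm \<sigma> \<tau> z)"
  "ren_fm r q (unique_code x y z) = unique_code (ren_trm r q x) (ren_trm r q y) (ren_trm r q z)"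
  by (simp_all add: unique_code_def)

lemma wf_uniquely_coded [simp]: "wf_trm L z \<Longrightarrow> wf_fm L (uniquely_coded z)"
  by (simp add: uniquely_coded_def)

lemma sub_uniquely_coded [simp]: "sub_fm \<sigma> \<tau> (uniquely_coded z) = uniquely_coded (sub_trm \<sigma> \<tau> z)"
  by (simp add: uniquely_coded_def)

lemma unique_codeD:
  assumes "\<Gamma> \<turnstile> unique_code x y z" "\<Gamma> \<turnstile> pair s t \<doteq> z" and [simp]: "wf_trm L s" "wf_trm L t"
  shows "\<Gamma> \<turnstile> s \<doteq> x" "\<Gamma> \<turnstile> t \<doteq> y"
proof -
  have "\<Gamma> \<turnstile> AllN (pair (liftT s) v0 \<doteq> liftT z \<^bold>\<longrightarrow> liftT s \<doteq> liftT x \<^bold>\<and> v0 \<doteq> liftT y)"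
    using ded.AllNE[OF assms(1)[unfolded unique_code_def], of s] by (simp add: instN_def)
  from ded.AllNE[OF this, of t] have "\<Gamma> \<turnstile> pair s t \<doteq> z \<^bold>\<longrightarrow> s \<doteq> x \<^bold>\<and> t \<doteq> y"
    by (simp add: instN_def)
  with assms(2) have "\<Gamma> \<turnstile> s \<doteq> x \<^bold>\<and> t \<doteq> y" by (rule ded.ImpE[rotated])
  then show "\<Gamma> \<turnstile> s \<doteq> x" "\<Gamma> \<turnstile> t \<doteq> y" by (blast intro: ded.AndE1 ded.AndE2)+
qed

text \<open>A competing pair is split into exactly the three shapes for which inversion facts are at
  hand.\<close>

lemma unique_codeI:
  assumes [simp]: "wf_trm L x" "wf_trm L y" "wf_trm L z"
    and "(pair Z Z \<doteq> z) # \<Gamma> \<turnstile> Z \<doteq> x \<^bold>\<and> Z \<doteq> y"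
    and "(pair Z (S v0) \<doteq> liftT z) # map liftN \<Gamma> \<turnstile> Z \<doteq> liftT x \<^bold>\<and> S v0 \<doteq> liftT y"
    and "(pair (S v1) v0 \<doteq> liftT (liftT z)) # map liftN (map liftN \<Gamma>) \<turnstile>
      S v1 \<doteq> liftT (liftT x) \<^bold>\<and> v0 \<doteq> liftT (liftT y)"
  shows "\<Gamma> \<turnstile> unique_code x y z"
  unfolding unique_code_def
proof (rule nat_cases_rule)
  show "map liftN \<Gamma> \<turnstile> sub_fm (case_nat (S v0) (\<lambda>n. NVar (Suc n))) FVar
      (AllN (pair v1 v0 \<doteq> liftT (liftT z) \<^bold>\<longrightarrow> v1 \<doteq> liftT (liftT x) \<^bold>\<and> v0 \<doteq> liftT (liftT y)))"
    using assms(6)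
    by (auto intro!: ded.AllNI ded.ImpI)
  have "\<Gamma> \<turnstile> AllN (pair Z v0 \<doteq> liftT z \<^bold>\<longrightarrow> Z \<doteq> liftT x \<^bold>\<and> v0 \<doteq> liftT y)"
  proof (rule nat_cases_rule)
    show "\<Gamma> \<turnstile> instN (pair Z v0 \<doteq> liftT z \<^bold>\<longrightarrow> Z \<doteq> liftT x \<^bold>\<and> v0 \<doteq> liftT y) Z"
      using assms(4) by (simp add: instN_def ded.ImpI)
    show "map liftN \<Gamma> \<turnstile> sub_fm (case_nat (S v0) (\<lambda>n. NVar (Suc n))) FVar
        (pair Z v0 \<doteq> liftT z \<^bold>\<longrightarrow> Z \<doteq> liftT x \<^bold>\<and> v0 \<doteq> liftT y)"
      using assms(5) by (auto intro!: ded.ImpI)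
  qed simp
  then show "\<Gamma> \<turnstile> instN (AllN (pair v1 v0 \<doteq> liftT (liftT z) \<^bold>\<longrightarrow>
      v1 \<doteq> liftT (liftT x) \<^bold>\<and> v0 \<doteq> liftT (liftT y))) Z"
    by (simp add: instN_def)
qed simp

lemma unique_code_zero: "\<Gamma> \<turnstile> unique_code Z Z Z"
proof (rule unique_codeI)
  show "(pair Z Z \<doteq> Z) # \<Gamma> \<turnstile> Z \<doteq> Z \<^bold>\<and> Z \<doteq> Z" by (intro ded.AndI eq_refl) simp_all
  show "(pair Z (S v0) \<doteq> liftT Z) # map liftN \<Gamma> \<turnstile> Z \<doteq> liftT Z \<^bold>\<and> S v0 \<doteq> liftT Z"
    by (rule pair_zero_suc_neq[OF ded.Assm, of v0]) simp_all
  show "(pair (S v1) v0 \<doteq> liftT (liftT Z)) # map liftN (map liftN \<Gamma>) \<turnstile>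
      S v1 \<doteq> liftT (liftT Z) \<^bold>\<and> v0 \<doteq> liftT (liftT Z)"
    by (rule pair_suc_neq[OF ded.Assm, of v1 v0]) simp_all
qed simp_all

text \<open>Codes follow the diagonals: the pair after \<open>(x, y')\<close> is \<open>(x', y)\<close>, and the pair after
  \<open>(x, 0)\<close> is \<open>(0, x')\<close>.\<close>

lemma unique_code_suc_diagonal:
  assumes u: "\<Gamma> \<turnstile> unique_code x (S y) z" and [simp]: "wf_trm L x" "wf_trm L y" "wf_trm L z"
  shows "\<Gamma> \<turnstile> unique_code (S x) y (S z)"
proof (rule unique_codeI)
  show "(pair Z Z \<doteq> S z) # \<Gamma> \<turnstile> Z \<doteq> S x \<^bold>\<and> Z \<doteq> y"
    by (rule pair_zero_zero_neq[OF ded.Assm, of z]) simp_all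
  let ?\<Delta> = "(pair Z (S v0) \<doteq> S (liftT z)) # map liftN \<Gamma>"
  have "?\<Delta> \<turnstile> unique_code (liftT x) (S (liftT y)) (liftT z)"
    using ded_liftN[OF u] by (intro ded_weaken_Cons) simp
  \<comment> \<open>A competitor \<open>(0, S v0)\<close> steps back to \<open>(v0, 0)\<close>,
    whose second component would have to equal \<open>S y\<close>.\<close>
  moreover have "?\<Delta> \<turnstile> pair v0 Z \<doteq> liftT z"
    by (rule pair_zero_suc_eq_suc[OF ded.Assm]) simp_all
  ultimately have "?\<Delta> \<turnstile> Z \<doteq> S (liftT y)" by (rule unique_codeD) simp_all
  then show "(pair Z (S v0) \<doteq> liftT (S z)) # map liftN \<Gamma> \<turnstile> Z \<doteq> liftT (S x) \<^bold>\<and> S v0 \<doteq> liftT y"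
    using suc_neq'[of ?\<Delta> "liftT y"] by simp
  let ?\<Delta> = "(pair (S v1) v0 \<doteq> S (liftT (liftT z))) # map liftN (map liftN \<Gamma>)"
  have *: "?\<Delta> \<turnstile> unique_code (liftT (liftT x)) (S (liftT (liftT y))) (liftT (liftT z))"
    using ded_liftN[OF ded_liftN[OF u]] by (intro ded_weaken_Cons) simp
  \<comment> \<open>Stepping back from \<open>(S v1, v0)\<close> gives \<open>(v1, S v0)\<close>,
    which uniqueness for \<open>z\<close> identifies with \<open>(x, S y)\<close>.\<close>
  have **: "?\<Delta> \<turnstile> pair v1 (S v0) \<doteq> liftT (liftT z)"
    by (rule pair_suc_eq_suc[OF ded.Assm]) simp_all
  have "?\<Delta> \<turnstile> S v1 \<doteq> S (liftT (liftT x)) \<^bold>\<and> v0 \<doteq> liftT (liftT y)"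
    by (rule ded.AndI[OF suc_cong[OF unique_codeD(1)[OF * **]] suc_inj[OF unique_codeD(2)[OF * **]]]) simp_all
  then show "(pair (S v1) v0 \<doteq> liftT (liftT (S z))) # map liftN (map liftN \<Gamma>) \<turnstile>
      S v1 \<doteq> liftT (liftT (S x)) \<^bold>\<and> v0 \<doteq> liftT (liftT y)" by simp
qed simp_all

lemma unique_code_suc_axis:
  assumes u: "\<Gamma> \<turnstile> unique_code x Z z" and [simp]: "wf_trm L x" "wf_trm L z"
  shows "\<Gamma> \<turnstile> unique_code Z (S x) (S z)"
proof (rule unique_codeI)
  show "(pair Z Z \<doteq> S z) # \<Gamma> \<turnstile> Z \<doteq> Z \<^bold>\<and> Z \<doteq> S x"
    by (rule pair_zero_zero_neq[OF ded.Assm, of z]) simp_all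
  let ?\<Delta> = "(pair Z (S v0) \<doteq> S (liftT z)) # map liftN \<Gamma>"
  have *: "?\<Delta> \<turnstile> unique_code (liftT x) Z (liftT z)"
    using ded_liftN[OF u] by (intro ded_weaken_Cons) simp
  \<comment> \<open>The competitor \<open>(0, S v0)\<close> steps back to \<open>(v0, 0)\<close>, so
    \<open>v0\<close> must be \<open>x\<close>.\<close>
  have **: "?\<Delta> \<turnstile> pair v0 Z \<doteq> liftT z"
    by (rule pair_zero_suc_eq_suc[OF ded.Assm]) simp_all
  have "?\<Delta> \<turnstile> Z \<doteq> Z \<^bold>\<and> S v0 \<doteq> S (liftT x)"
    by (rule ded.AndI[OF eq_refl suc_cong[OF unique_codeD(1)[OF * **]]]) simp_all
  then show "(pair Z (S v0) \<doteq> liftT (S z)) # map liftN \<Gamma> \<turnstile> Z \<doteq> liftT Z \<^bold>\<and> S v0 \<doteq> liftT (S x)"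
    by simp
  let ?\<Delta> = "(pair (S v1) v0 \<doteq> S (liftT (liftT z))) # map liftN (map liftN \<Gamma>)"
  have "?\<Delta> \<turnstile> unique_code (liftT (liftT x)) Z (liftT (liftT z))"
    using ded_liftN[OF ded_liftN[OF u]] by (intro ded_weaken_Cons) simp
  \<comment> \<open>Here the preceding pair has a successor as second component, whereas uniqueness
    for \<open>z\<close> requires zero.\<close>
  moreover have "?\<Delta> \<turnstile> pair v1 (S v0) \<doteq> liftT (liftT z)"
    by (rule pair_suc_eq_suc[OF ded.Assm]) simp_all
  ultimately have "?\<Delta> \<turnstile> S v0 \<doteq> Z" by (rule unique_codeD) simp_all
  then show "(pair (S v1) v0 \<doteq> liftT (liftT (S z))) # map liftN (map liftN \<Gamma>) \<turnstile>
      S v1 \<doteq> liftT (liftT Z) \<^bold>\<and> v0 \<doteq> liftT (liftT (S x))"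
    using suc_neq[of ?\<Delta> v0] by simp
qed simp_all

lemma uniquely_codedI:
  assumes "\<Gamma> \<turnstile> pair x y \<doteq> z" "\<Gamma> \<turnstile> unique_code x y z"
    and [simp]: "wf_trm L x" "wf_trm L y" "wf_trm L z"
  shows "\<Gamma> \<turnstile> uniquely_coded z"
  unfolding uniquely_coded_def
proof (rule ded.ExNI[of _ _ x])
  have "\<Gamma> \<turnstile> ExN (pair (liftT x) v0 \<doteq> liftT z \<^bold>\<and> unique_code (liftT x) v0 (liftT z))"
    by (rule ded.ExNI[of _ _ y]) (simp_all add: instN_def ded.AndI assms)
  then show "\<Gamma> \<turnstile> instN (ExN (pair v1 v0 \<doteq> liftT (liftT z) \<^bold>\<and> unique_code v1 v0 (liftT (liftT z)))) x"
    by (simp add: instN_def)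
qed simp_all

text \<open>Whether the next code continues the diagonal or opens a new one depends on
  \<open>y\<close> being zero, so the theory itself has to distinguish cases on
  \<open>y\<close>.\<close>

lemma uniquely_coded_suc:
  assumes "\<Gamma> \<turnstile> pair x y \<doteq> z" "\<Gamma> \<turnstile> unique_code x y z"
    and [simp]: "wf_trm L x" "wf_trm L y" "wf_trm L z"
  shows "\<Gamma> \<turnstile> uniquely_coded (S z)"
proof -
  let ?P = "\<lambda>x y z. pair x y \<doteq> z \<^bold>\<and> unique_code x y z"
  \<comment> \<open>What is known about \<open>y\<close> becomes a premise inside the quantified
    formula, because the cases rule acts on a bound variable.\<close>
  have "\<Gamma> \<turnstile> AllN (?P (liftT x) v0 (liftT z) \<^bold>\<longrightarrow> uniquely_coded (S (liftT z)))"
  proof (rule nat_cases_rule)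
    let ?\<Delta> = "?P x Z z # \<Gamma>"
    have P: "?\<Delta> \<turnstile> ?P x Z z" by (simp add: ded.Assm)
    have "?\<Delta> \<turnstile> uniquely_coded (S z)"
      by (rule uniquely_codedI[OF eq_trans[OF pair_zero_suc suc_cong[OF ded.AndE1[OF P]]]
            unique_code_suc_axis[OF ded.AndE2[OF P]]]) simp_all
    then show "\<Gamma> \<turnstile> instN (?P (liftT x) v0 (liftT z) \<^bold>\<longrightarrow> uniquely_coded (S (liftT z))) Z"
      by (simp add: instN_def ded.ImpI)
    let ?\<Delta> = "?P (liftT x) (S v0) (liftT z) # map liftN \<Gamma>"
    have P: "?\<Delta> \<turnstile> ?P (liftT x) (S v0) (liftT z)" by (simp add: ded.Assm)
    have "?\<Delta> \<turnstile> uniquely_coded (S (liftT z))"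
      by (rule uniquely_codedI[OF eq_trans[OF pair_suc suc_cong[OF ded.AndE1[OF P]]]
            unique_code_suc_diagonal[OF ded.AndE2[OF P]]]) simp_all
    then show "map liftN \<Gamma> \<turnstile> sub_fm (case_nat (S v0) (\<lambda>n. NVar (Suc n))) FVar
        (?P (liftT x) v0 (liftT z) \<^bold>\<longrightarrow> uniquely_coded (S (liftT z)))"
      by (simp add: ded.ImpI)
  qed simp
  from ded.AllNE[OF this, of y] have "\<Gamma> \<turnstile> ?P x y z \<^bold>\<longrightarrow> uniquely_coded (S z)" by (simp add: instN_def)
  then show ?thesis using ded.AndI[OF assms(1,2)] by (rule ded.ImpE)
qed

lemma uniquely_codedE':
  assumes "\<Gamma> \<turnstile> uniquely_coded z"
    and "(pair v1 v0 \<doteq> liftT (liftT z) \<^bold>\<and> unique_code v1 v0 (liftT (liftT z))) # map liftN (map liftN \<Gamma>) \<turnstile>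
      liftN (liftN C)"
  shows "\<Gamma> \<turnstile> C"
  using assms(1)[unfolded uniquely_coded_def]
proof (rule ded.ExNE)
  let ?P = "pair v1 v0 \<doteq> liftT (liftT z) \<^bold>\<and> unique_code v1 v0 (liftT (liftT z))"
  show "ExN ?P # map liftN \<Gamma> \<turnstile> liftN C"
    by (rule ded.ExNE[of _ _ _ ?P]) (auto intro: ded.Assm ded_weaken[OF assms(2)])
qed

lemma uniquely_coded_all: "wf_trm L z \<Longrightarrow> \<Gamma> \<turnstile> uniquely_coded z"
proof -
  have "[] \<turnstile> AllN (uniquely_coded v0)"
  proof (rule nat_induct_rule)
    show "[] \<turnstile> instN (uniquely_coded v0) Z"
      by (simp add: instN_def) (rule uniquely_codedI[OF pair_zero_zero unique_code_zero]; simp)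
    have "[uniquely_coded v0] \<turnstile> uniquely_coded (S v0)"
    proof (rule uniquely_codedE')
      show "[uniquely_coded v0] \<turnstile> uniquely_coded v0" by (simp add: ded.Assm)
      let ?\<Gamma> = "(pair v1 v0 \<doteq> liftT (liftT v0) \<^bold>\<and> unique_code v1 v0 (liftT (liftT v0))) #
        map liftN (map liftN [uniquely_coded v0])"
      have P: "?\<Gamma> \<turnstile> pair v1 v0 \<doteq> v2 \<^bold>\<and> unique_code v1 v0 v2" by (simp add: ded.Assm)
      have "?\<Gamma> \<turnstile> uniquely_coded (S v2)"
        by (rule uniquely_coded_suc[OF ded.AndE1[OF P] ded.AndE2[OF P]]) simp_all
      then show "?\<Gamma> \<turnstile> liftN (liftN (uniquely_coded (S v0)))" by (simp add: ren_fm_eq_sub)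
    qed
    then show "uniquely_coded v0 # map liftN [] \<turnstile>
        sub_fm (case_nat (S v0) (\<lambda>n. NVar (Suc n))) FVar (uniquely_coded v0)" by simp
  qed simp
  from ded_inst[OF ded_open[OF this], of "\<lambda>_. z"] show "wf_trm L z \<Longrightarrow> ?thesis" by simp
qed

text \<open>Surjectivity in usable form: a given number may be taken to be the code of two fresh
  components \<open>v1\<close> and \<open>v0\<close>.\<close>

lemma unpair_cases:
  assumes "wf_trm L z"
    and "(pair v1 v0 \<doteq> liftT (liftT z)) # map liftN (map liftN \<Gamma>) \<turnstile> liftN (liftN C)"
  shows "\<Gamma> \<turnstile> C"
proof (rule uniquely_codedE'[OF uniquely_coded_all[OF assms(1)]])
  let ?\<Delta> = "(pair v1 v0 \<doteq> liftT (liftT z) \<^bold>\<and> unique_code v1 v0 (liftT (liftT z))) # map liftN (map liftN \<Gamma>)"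
  have "?\<Delta> \<turnstile> pair v1 v0 \<doteq> liftT (liftT z) \<^bold>\<longrightarrow> liftN (liftN C)"
    by (rule ded_weaken_Cons, rule ded.ImpI[OF _ assms(2)]) (simp add: assms(1))
  moreover have "?\<Delta> \<turnstile> pair v1 v0 \<doteq> liftT (liftT z)"
    by (rule ded.AndE1[OF ded.Assm[OF list.set_intros(1)]])
  ultimately show "?\<Delta> \<turnstile> liftN (liftN C)" by (rule ded.ImpE)
qed

text \<open>Both pairs have the code \<open>pair s' t'\<close>, so each agrees with the components
  \<open>v1\<close>, \<open>v0\<close> to which that code uniquely decodes.\<close>

lemma pair_inj_conj:
  assumes e: "\<Gamma> \<turnstile> pair s t \<doteq> pair s' t'"
    and [simp]: "wf_trm L s" "wf_trm L t" "wf_trm L s'" "wf_trm L t'"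
  shows "\<Gamma> \<turnstile> s \<doteq> s' \<^bold>\<and> t \<doteq> t'"
proof (rule uniquely_codedE'[OF uniquely_coded_all])
  let ?l = "\<lambda>t. liftT (liftT t)"
  let ?\<Delta> = "(pair v1 v0 \<doteq> ?l (pair s' t') \<^bold>\<and> unique_code v1 v0 (?l (pair s' t'))) # map liftN (map liftN \<Gamma>)"
  have U: "?\<Delta> \<turnstile> unique_code v1 v0 (pair (?l s') (?l t'))"
    using ded.AndE2[OF ded.Assm[OF list.set_intros(1)]] by simp
  have s: "?\<Delta> \<turnstile> pair (?l s) (?l t) \<doteq> pair (?l s') (?l t')"
    using ded_liftN[OF ded_liftN[OF e]] by (intro ded_weaken_Cons) simp
  have s': "?\<Delta> \<turnstile> pair (?l s') (?l t') \<doteq> pair (?l s') (?l t')" by (rule eq_refl) simp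
  have "?\<Delta> \<turnstile> ?l s \<doteq> ?l s' \<^bold>\<and> ?l t \<doteq> ?l t'"
    by (rule ded.AndI[OF eq_trans[OF unique_codeD(1)[OF U s] eq_sym[OF unique_codeD(1)[OF U s']]]
          eq_trans[OF unique_codeD(2)[OF U s] eq_sym[OF unique_codeD(2)[OF U s']]]]) simp_all
  then show "?\<Delta> \<turnstile> liftN (liftN (s \<doteq> s' \<^bold>\<and> t \<doteq> t'))" by simp
qed simp

lemmas pair_inj = ded.AndE1[OF pair_inj_conj] ded.AndE2[OF pair_inj_conj]


section \<open>Choice for a decidable graph\<close>

text \<open>\<open>At A \<sigma> \<tau> s t\<close> is \<open>A(s, t)\<close> with the parameters of \<open>A\<close> replaced according to
  \<open>\<sigma>\<close> and \<open>\<tau>\<close>.\<close>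

definition At :: "'c fm \<Rightarrow> (nat \<Rightarrow> 'c trm) \<Rightarrow> (nat \<Rightarrow> 'c fnc) \<Rightarrow> 'c trm \<Rightarrow> 'c trm \<Rightarrow> 'c fm" where
  "At A \<sigma> \<tau> s t = sub_fm (case_nat t (case_nat s \<sigma>)) \<tau> A"

lemma sub_At [simp]:
  "sub_fm \<sigma>' \<tau>' (At A \<sigma> \<tau> s t) = At A (\<lambda>n. sub_trm \<sigma>' \<tau>' (\<sigma> n)) (\<lambda>n. sub_fnc \<sigma>' \<tau>' (\<tau> n))
     (sub_trm \<sigma>' \<tau>' s) (sub_trm \<sigma>' \<tau>' t)"
  unfolding At_def sub_sub_fm by (rule sub_fm_cong) (auto split: nat.split)

lemma ren_At [simp]:
  "ren_fm r q (At A \<sigma> \<tau> s t) = At A (\<lambda>n. ren_trm r q (\<sigma> n)) (\<lambda>n. ren_fnc r q (\<tau> n))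
     (ren_trm r q s) (ren_trm r q t)"
  by (simp add: ren_fm_eq_sub ren_trm_eq_sub ren_fnc_eq_sub)

lemma wf_At [simp]:
  "wf_fm L A \<Longrightarrow> wf_sub L \<sigma> \<tau> \<Longrightarrow> wf_trm L s \<Longrightarrow> wf_trm L t \<Longrightarrow> wf_fm L (At A \<sigma> \<tau> s t)"
  unfolding At_def by (rule wf_sub_fm) (auto simp: wf_sub_def split: nat.split)

abbreviation lift\<sigma> :: "(nat \<Rightarrow> 'c trm) \<Rightarrow> nat \<Rightarrow> 'c trm" where
  "lift\<sigma> \<sigma> \<equiv> (\<lambda>n. liftT (\<sigma> n))"

abbreviation lift\<tau> :: "(nat \<Rightarrow> 'c fnc) \<Rightarrow> nat \<Rightarrow> 'c fnc" where
  "lift\<tau> \<tau> \<equiv> (\<lambda>n. ren_fnc Suc id (\<tau> n))"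

lemma wf_sub_lift [simp]: "wf_sub L (lift\<sigma> \<sigma>) (lift\<tau> \<tau>) \<longleftrightarrow> wf_sub L \<sigma> \<tau>"
  by (simp add: wf_sub_def)

lemma At_cong:
  assumes "\<Gamma> \<turnstile> At A \<sigma> \<tau> s t" "\<Gamma> \<turnstile> s \<doteq> s'" "\<Gamma> \<turnstile> t \<doteq> t'" and [simp]: "wf_fm L A" "wf_sub L \<sigma> \<tau>"
    "wf_trm L s" "wf_trm L s'" "wf_trm L t" "wf_trm L t'"
  shows "\<Gamma> \<turnstile> At A \<sigma> \<tau> s' t'"
proof -
  have "\<Gamma> \<turnstile> At A \<sigma> \<tau> s' t"
    using replacement[of "At A (lift\<sigma> \<sigma>) (lift\<tau> \<tau>) v0 (liftT t)" s s' \<Gamma>] assms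
    by (simp add: instN_def)
  then show ?thesis
    using replacement[of "At A (lift\<sigma> \<sigma>) (lift\<tau> \<tau>) (liftT s') v0" t t' \<Gamma>] assms
    by (simp add: instN_def)
qed

text \<open>An explicit substitution for the parameters keeps the hypothesis an instance of one
  expression while it is shifted through several binders.\<close>

definition total_unique :: "'c fm \<Rightarrow> (nat \<Rightarrow> 'c trm) \<Rightarrow> (nat \<Rightarrow> 'c fnc) \<Rightarrow> 'c fm" where
  "total_unique A \<sigma> \<tau> = sub_fm \<sigma> \<tau> (AllN (ExN1 A))"

lemma ren_total_unique [simp]:
  "ren_fm r q (total_unique A \<sigma> \<tau>) =
   total_unique A (\<lambda>n. ren_trm r q (\<sigma> n)) (\<lambda>n. ren_fnc r q (\<tau> n))"
  unfolding total_unique_def ren_fm_eq_sub sub_sub_fm ren_trm_eq_sub ren_fnc_eq_sub ..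

text \<open>The uniqueness clause of \<open>ExN1\<close> contains a renamed copy of
  \<open>A\<close>. Expressed with \<open>At\<close>, both copies are visibly instances of the same
  formula at \<open>x\<close>.\<close>

lemma total_unique_inst:
  assumes "\<Gamma> \<turnstile> total_unique A \<sigma> \<tau>" "wf_trm L x"
  shows "\<Gamma> \<turnstile> ExN (At A (lift\<sigma> \<sigma>) (lift\<tau> \<tau>) (liftT x) v0 \<^bold>\<and>
    AllN (At A (lift\<sigma> (lift\<sigma> \<sigma>)) (lift\<tau> (lift\<tau> \<tau>)) (liftT (liftT x)) v0 \<^bold>\<longrightarrow> v1 \<doteq> v0))"
proof -
  have "\<Gamma> \<turnstile> sub_fm (case_nat x \<sigma>) \<tau> (ExN1 A)"
    using ded.AllNE[OF assms(1)[unfolded total_unique_def sub_fm.simps] assms(2)]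
    by (simp add: instN_sub_upN)
  also have "sub_fm (case_nat x \<sigma>) \<tau> (ExN1 A) = ExN (At A (lift\<sigma> \<sigma>) (lift\<tau> \<tau>) (liftT x) v0 \<^bold>\<and>
    AllN (At A (lift\<sigma> (lift\<sigma> \<sigma>)) (lift\<tau> (lift\<tau> \<tau>)) (liftT (liftT x)) v0 \<^bold>\<longrightarrow> v1 \<doteq> v0))"
    by (auto simp: ExN1_def At_def ren_fm_eq_sub sub_sub_fm upN_trm_def upN_fnc_def
             intro!: sub_fm_cong split: nat.split)
  finally show ?thesis .
qed

lemma total_unique_cases:
  assumes "\<Gamma> \<turnstile> total_unique A \<sigma> \<tau>" and [simp]: "wf_trm L x" "wf_fm L A" "wf_sub L \<sigma> \<tau>"
    and C: "At A (lift\<sigma> \<sigma>) (lift\<tau> \<tau>) (liftT x) v0 # map liftN \<Gamma> \<turnstile> liftN C"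
  shows "\<Gamma> \<turnstile> C"
  using total_unique_inst[OF assms(1,2)]
proof (rule ded.ExNE, goal_cases)
  case 1
  show ?case
    by (rule ded.ImpE[OF ded_weaken_Cons[OF ded.ImpI[OF _ C]]
          ded.AndE1[OF ded.Assm[OF list.set_intros(1)]]]) simp
qed

text \<open>The clause in \<open>ExN1\<close> compares values only with the witness of its
  existential quantifier, so \<open>y\<close> and \<open>y'\<close> are linked through that
  witness.\<close>

lemma total_unique_unique:
  assumes h: "\<Gamma> \<turnstile> total_unique A \<sigma> \<tau>"
    and y: "\<Gamma> \<turnstile> At A \<sigma> \<tau> x y" "\<Gamma> \<turnstile> At A \<sigma> \<tau> x y'"
    and [simp]: "wf_trm L x" "wf_trm L y" "wf_trm L y'"
  shows "\<Gamma> \<turnstile> y \<doteq> y'"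
  using total_unique_inst[OF h assms(4)]
proof (rule ded.ExNE, goal_cases)
  case 1
  let ?\<Delta> = "(At A (lift\<sigma> \<sigma>) (lift\<tau> \<tau>) (liftT x) v0 \<^bold>\<and>
    AllN (At A (lift\<sigma> (lift\<sigma> \<sigma>)) (lift\<tau> (lift\<tau> \<tau>)) (liftT (liftT x)) v0 \<^bold>\<longrightarrow> v1 \<doteq> v0)) # map liftN \<Gamma>"
  have A: "?\<Delta> \<turnstile> AllN (At A (lift\<sigma> (lift\<sigma> \<sigma>)) (lift\<tau> (lift\<tau> \<tau>)) (liftT (liftT x)) v0 \<^bold>\<longrightarrow> v1 \<doteq> v0)"
    by (rule ded.AndE2[OF ded.Assm[OF list.set_intros(1)]])
  have *: "?\<Delta> \<turnstile> v0 \<doteq> liftT z" if z: "\<Gamma> \<turnstile> At A \<sigma> \<tau> x z" and [simp]: "wf_trm L z" for z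
  proof (rule ded.ImpE)
    show "?\<Delta> \<turnstile> At A (lift\<sigma> \<sigma>) (lift\<tau> \<tau>) (liftT x) (liftT z)"
      using ded_liftN[OF z] by (intro ded_weaken_Cons) simp
    show "?\<Delta> \<turnstile> At A (lift\<sigma> \<sigma>) (lift\<tau> \<tau>) (liftT x) (liftT z) \<^bold>\<longrightarrow> v0 \<doteq> liftT z"
      using ded.AllNE[OF A, of "liftT z"] by (simp add: instN_def)
  qed
  show ?case
    using eq_trans[OF eq_sym[OF *[OF y(1)]] *[OF y(2)]] by simp
qed

text \<open>The formula B of the overview. The components are quantified in place of being computed
  by projections; the quantifiers do no harm, as \<open>CF_d\<close> restricts B only by
  decidability.\<close>

definition graph :: "'c fm \<Rightarrow> (nat \<Rightarrow> 'c trm) \<Rightarrow> (nat \<Rightarrow> 'c fnc) \<Rightarrow> 'c trm \<Rightarrow> 'c fm" where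
  "graph A \<sigma> \<tau> z = ExN (ExN (pair v1 v0 \<doteq> liftT (liftT z) \<^bold>\<and>
     At A (lift\<sigma> (lift\<sigma> \<sigma>)) (lift\<tau> (lift\<tau> \<tau>)) v1 v0))"

lemma sub_graph [simp]:
  "sub_fm \<sigma>' \<tau>' (graph A \<sigma> \<tau> z) =
     graph A (\<lambda>n. sub_trm \<sigma>' \<tau>' (\<sigma> n)) (\<lambda>n. sub_fnc \<sigma>' \<tau>' (\<tau> n)) (sub_trm \<sigma>' \<tau>' z)"
  by (simp add: graph_def)

lemma ren_graph [simp]:
  "ren_fm r q (graph A \<sigma> \<tau> z) =
     graph A (\<lambda>n. ren_trm r q (\<sigma> n)) (\<lambda>n. ren_fnc r q (\<tau> n)) (ren_trm r q z)"
  by (simp add: ren_fm_eq_sub ren_trm_eq_sub ren_fnc_eq_sub)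

lemma wf_graph [simp]:
  "wf_fm L A \<Longrightarrow> wf_sub L \<sigma> \<tau> \<Longrightarrow> wf_trm L z \<Longrightarrow> wf_fm L (graph A \<sigma> \<tau> z)"
  by (simp add: graph_def)

lemma graphI:
  assumes "\<Gamma> \<turnstile> pair x y \<doteq> z" "\<Gamma> \<turnstile> At A \<sigma> \<tau> x y"
    and [simp]: "wf_fm L A" "wf_sub L \<sigma> \<tau>" "wf_trm L x" "wf_trm L y" "wf_trm L z"
  shows "\<Gamma> \<turnstile> graph A \<sigma> \<tau> z"
  unfolding graph_def
proof (rule ded.ExNI[of _ _ x])
  have "\<Gamma> \<turnstile> ExN (pair (liftT x) v0 \<doteq> liftT z \<^bold>\<and> At A (lift\<sigma> \<sigma>) (lift\<tau> \<tau>) (liftT x) v0)"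
    by (rule ded.ExNI[of _ _ y]) (simp_all add: instN_def ded.AndI assms)
  then show "\<Gamma> \<turnstile> instN (ExN (pair v1 v0 \<doteq> liftT (liftT z) \<^bold>\<and>
     At A (lift\<sigma> (lift\<sigma> \<sigma>)) (lift\<tau> (lift\<tau> \<tau>)) v1 v0)) x"
    by (simp add: instN_def)
qed simp_all

text \<open>Injectivity of pairing enters here: the components hidden by the existential quantifiers
  must be recognised as \<open>x\<close> and \<open>y\<close>.\<close>

lemma graph_pairD:
  assumes "\<Gamma> \<turnstile> graph A \<sigma> \<tau> (pair x y)"
    and [simp]: "wf_fm L A" "wf_sub L \<sigma> \<tau>" "wf_trm L x" "wf_trm L y"
  shows "\<Gamma> \<turnstile> At A \<sigma> \<tau> x y"
  using assms(1)[unfolded graph_def]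
proof (rule ded.ExNE)
  let ?l = "\<lambda>t. liftT (liftT t)"
  let ?P = "pair v1 v0 \<doteq> ?l (pair x y) \<^bold>\<and> At A (lift\<sigma> (lift\<sigma> \<sigma>)) (lift\<tau> (lift\<tau> \<tau>)) v1 v0"
  let ?C = "At A \<sigma> \<tau> x y"
  show "ExN ?P # map liftN \<Gamma> \<turnstile> liftN ?C"
  proof (rule ded.ExNE[OF ded.Assm[OF list.set_intros(1)]])
    let ?\<Delta> = "?P # map liftN (ExN ?P # map liftN \<Gamma>)"
    have P: "?\<Delta> \<turnstile> ?P" by (rule ded.Assm[OF list.set_intros(1)])
    have E: "?\<Delta> \<turnstile> pair v1 v0 \<doteq> pair (?l x) (?l y)" using ded.AndE1[OF P] by simp
    have "?\<Delta> \<turnstile> At A (lift\<sigma> (lift\<sigma> \<sigma>)) (lift\<tau> (lift\<tau> \<tau>)) (?l x) (?l y)"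
      by (rule At_cong[OF ded.AndE2[OF P] pair_inj[OF E]]) simp_all
    then show "?\<Delta> \<turnstile> liftN (liftN ?C)" by simp
  qed
qed

text \<open>Decode \<open>z\<close> as a pair (x, y) and let y0 be the value at x. Then A(x, y)
  holds exactly when y0 = y, and that equation is decidable.\<close>

lemma graph_decidable:
  assumes h: "\<Gamma> \<turnstile> total_unique A \<sigma> \<tau>" and [simp]: "wf_fm L A" "wf_sub L \<sigma> \<tau>" "wf_trm L z"
  shows "\<Gamma> \<turnstile> graph A \<sigma> \<tau> z \<^bold>\<or> \<^bold>\<not> graph A \<sigma> \<tau> z"
proof (rule unpair_cases[of z])
  let ?\<Delta> = "(pair v1 v0 \<doteq> liftT (liftT z)) # map liftN (map liftN \<Gamma>)"
  have h2: "?\<Delta> \<turnstile> total_unique A (lift\<sigma> (lift\<sigma> \<sigma>)) (lift\<tau> (lift\<tau> \<tau>))"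
    using ded_liftN[OF ded_liftN[OF h]] by (intro ded_weaken_Cons) simp
  define \<sigma>' \<tau>' where "\<sigma>' = lift\<sigma> (lift\<sigma> (lift\<sigma> \<sigma>))" and "\<tau>' = lift\<tau> (lift\<tau> (lift\<tau> \<tau>))"
  have [simp]: "wf_sub L \<sigma>' \<tau>'" unfolding \<sigma>'_def \<tau>'_def by simp
  let ?z = "liftT (liftT (liftT z))"
  show "?\<Delta> \<turnstile> liftN (liftN (graph A \<sigma> \<tau> z \<^bold>\<or> \<^bold>\<not> graph A \<sigma> \<tau> z))"
  proof (rule total_unique_cases[OF h2, of v1])
    \<comment> \<open>In this context \<open>v2\<close> and \<open>v1\<close> are the components of
      \<open>z\<close>, and \<open>v0\<close> is the value belonging to \<open>v2\<close>.\<close>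
    let ?\<Theta> = "At A \<sigma>' \<tau>' v2 v0 # map liftN ?\<Delta>"
    have h3: "?\<Theta> \<turnstile> total_unique A \<sigma>' \<tau>'"
      unfolding \<sigma>'_def \<tau>'_def using ded_liftN[OF h2] by (intro ded_weaken_Cons) simp
    have p: "?\<Theta> \<turnstile> pair v2 v1 \<doteq> ?z" by (rule ded.Assm) simp
    have a: "?\<Theta> \<turnstile> At A \<sigma>' \<tau>' v2 v0" by (rule ded.Assm) simp
    have "?\<Theta> \<turnstile> graph A \<sigma>' \<tau>' ?z \<^bold>\<or> \<^bold>\<not> graph A \<sigma>' \<tau>' ?z"
    proof (rule ded.OrE[OF eq_decidable[of v0 v1]])
      let ?\<Xi> = "(v0 \<doteq> v1) # ?\<Theta>"
      have "?\<Xi> \<turnstile> graph A \<sigma>' \<tau>' ?z"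
        by (rule graphI[OF ded_weaken_Cons[OF p] At_cong[OF ded_weaken_Cons[OF a] eq_refl ded.Assm]])
           simp_all
      then show "?\<Xi> \<turnstile> graph A \<sigma>' \<tau>' ?z \<^bold>\<or> \<^bold>\<not> graph A \<sigma>' \<tau>' ?z" by (rule ded.OrI1) simp
      let ?\<Xi> = "(\<^bold>\<not> (v0 \<doteq> v1)) # ?\<Theta>"
      let ?\<Xi>' = "graph A \<sigma>' \<tau>' ?z # ?\<Xi>"
      note weaken = ded_weaken_Cons[OF ded_weaken_Cons]
      have "?\<Xi>' \<turnstile> graph A \<sigma>' \<tau>' ?z" by (rule ded.Assm) simp
      then have "?\<Xi>' \<turnstile> graph A \<sigma>' \<tau>' (pair v2 v1)"
        using replacement[of "graph A (lift\<sigma> \<sigma>') (lift\<tau> \<tau>') v0" ?z "pair v2 v1" ?\<Xi>']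
          eq_sym[OF weaken[OF p], of "graph A \<sigma>' \<tau>' ?z" "\<^bold>\<not> (v0 \<doteq> v1)"]
        by (simp add: instN_def)
      then have "?\<Xi>' \<turnstile> At A \<sigma>' \<tau>' v2 v1" by (rule graph_pairD) simp_all
      \<comment> \<open>If \<open>z\<close> were in the graph, \<open>v1\<close> would also be a
        value at \<open>v2\<close>, and uniqueness would refute the present case.\<close>
      then have "?\<Xi>' \<turnstile> v0 \<doteq> v1"
        by (rule total_unique_unique[OF weaken[OF h3] weaken[OF a]]) simp_all
      then have "?\<Xi> \<turnstile> \<^bold>\<not> graph A \<sigma>' \<tau>' ?z"
        by (rule ded.NegI[rotated]) (simp_all add: ded.Assm)
      then show "?\<Xi> \<turnstile> graph A \<sigma>' \<tau>' ?z \<^bold>\<or> \<^bold>\<not> graph A \<sigma>' \<tau>' ?z" by (intro ded.OrI2) simp_all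
    qed simp_all
    then show "At A (lift\<sigma> (lift\<sigma> (lift\<sigma> \<sigma>))) (lift\<tau> (lift\<tau> (lift\<tau> \<tau>))) (liftT v1) v0 # map liftN ?\<Delta> \<turnstile>
        liftN (liftN (liftN (graph A \<sigma> \<tau> z \<^bold>\<or> \<^bold>\<not> graph A \<sigma> \<tau> z)))"
      by (simp add: \<sigma>'_def \<tau>'_def)
  qed simp_all
qed simp

lemma ded_IffD1: "\<Gamma> \<turnstile> Iff A B \<Longrightarrow> \<Gamma> \<turnstile> A \<^bold>\<longrightarrow> B"
  and ded_IffD2: "\<Gamma> \<turnstile> Iff A B \<Longrightarrow> \<Gamma> \<turnstile> B \<^bold>\<longrightarrow> A"
  unfolding Iff_def by (rule ded.AndE1, assumption) (rule ded.AndE2)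

lemma choice_fun_At: "choice_fun A =
    ExF (AllN (At A (\<lambda>n. NVar (Suc n)) (\<lambda>n. FVar (Suc n)) v0 (App (FVar 0) v0)))"
  unfolding choice_fun_def At_def by (auto intro!: sub_fm_cong split: nat.split)

theorem unique_choice:
  assumes [simp]: "wf_fm L A"
  shows "[] \<turnstile> AllN (ExN1 A) \<^bold>\<longrightarrow> choice_fun A"
proof (rule ded.ImpI)
  define H where "H = total_unique A NVar FVar"
  have H_eq: "AllN (ExN1 A) = H" unfolding H_def total_unique_def by (rule sub_fm_id[symmetric])
  \<comment> \<open>Index 0 is reserved for the code, so the number parameters of \<open>A\<close>
    move up by one.\<close>
  define B where "B = graph A (\<lambda>n. NVar (Suc n)) FVar v0"
  have [simp]: "wf_sub L (\<lambda>n. NVar (f n)) (\<lambda>n. FVar (g n))" "wf_sub L (\<lambda>n. NVar (f n)) FVar" for f g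
    by (simp_all add: wf_sub_def)
  have D: "[H] \<turnstile> AllN (B \<^bold>\<or> \<^bold>\<not> B)"
  proof (rule ded.AllNI)
    have "map liftN [H] \<turnstile> total_unique A (\<lambda>n. NVar (Suc n)) FVar"
      by (rule ded.Assm) (simp add: H_def)
    then show "map liftN [H] \<turnstile> B \<^bold>\<or> \<^bold>\<not> B" unfolding B_def by (rule graph_decidable) simp_all
  qed
  let ?C = "AllN (Le L (App (FVar 0) v0) (S Z) \<^bold>\<and> Iff (App (FVar 0) v0 \<doteq> Z) (liftF B))"
  have "[H] \<turnstile> AllN (B \<^bold>\<or> \<^bold>\<not> B) \<^bold>\<longrightarrow> ExF ?C"
    using schemata(3) by (intro ded.Axiom) (auto simp: CF_d_def B_def)
  then have "[H] \<turnstile> ExF ?C" using D by (rule ded.ImpE)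
  then show "[AllN (ExN1 A)] \<turnstile> choice_fun A" unfolding H_eq
  proof (rule ded.ExFE)
    let ?\<Gamma> = "?C # map liftF [H]"
    let ?\<sigma> = "\<lambda>n. NVar (Suc (Suc n))"
    let ?\<tau> = "\<lambda>n. FVar (Suc n)"
    have "?\<Gamma> \<turnstile> ?C" by (rule ded.Assm) simp
    \<comment> \<open>\<open>FVar 0\<close> is \<beta>; its defining property is read at the code of
      two fresh variables.\<close>
    from ded.AllNE[OF ded_liftN[OF ded_liftN[OF this], simplified ren_fm.simps], of "pair v1 v0"]
    have K: "map liftN (map liftN ?\<Gamma>) \<turnstile>
        Iff (App (FVar 0) (pair v1 v0) \<doteq> Z) (graph A ?\<sigma> ?\<tau> (pair v1 v0))"
      by (simp add: instN_def B_def Iff_def Le_def ded.AndE2)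
    let ?\<Gamma>' = "map liftN (map liftN ?\<Gamma>)"
    have K1: "?\<Gamma>' \<turnstile> At A ?\<sigma> ?\<tau> v1 v0 \<^bold>\<longrightarrow> App (FVar 0) (pair v1 v0) \<doteq> Z"
    proof (rule ded.ImpI)
      have "At A ?\<sigma> ?\<tau> v1 v0 # ?\<Gamma>' \<turnstile> graph A ?\<sigma> ?\<tau> (pair v1 v0)"
        by (rule graphI[OF eq_refl ded.Assm]) simp_all
      then show "At A ?\<sigma> ?\<tau> v1 v0 # ?\<Gamma>' \<turnstile> App (FVar 0) (pair v1 v0) \<doteq> Z"
        by (rule ded.ImpE[OF ded_weaken_Cons[OF ded_IffD2[OF K]]])
    qed simp
    have "?\<Gamma>' \<turnstile> App (FVar 0) (pair v1 v0) \<doteq> Z \<^bold>\<longrightarrow> At A ?\<sigma> ?\<tau> v1 v0"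
    proof (rule ded.ImpI)
      let ?E = "App (FVar 0) (pair v1 v0) \<doteq> Z"
      have "?E # ?\<Gamma>' \<turnstile> ?E" by (rule ded.Assm) simp
      then have "?E # ?\<Gamma>' \<turnstile> graph A ?\<sigma> ?\<tau> (pair v1 v0)"
        by (rule ded.ImpE[OF ded_weaken_Cons[OF ded_IffD1[OF K]]])
      then show "?E # ?\<Gamma>' \<turnstile> At A ?\<sigma> ?\<tau> v1 v0" by (rule graph_pairD) simp_all
    qed simp
    then have K2: "?\<Gamma> \<turnstile> AllN (AllN (App (FVar 0) (pair v1 v0) \<doteq> Z \<^bold>\<longrightarrow> At A ?\<sigma> ?\<tau> v1 v0))"
      by (intro ded.AllNI)
    \<comment> \<open>An equation with \<beta> as a parameter: the substitute for \<open>A\<close>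
      that quantifier-free choice accepts.\<close>
    let ?Q = "App (FVar 0) (pair v1 v0) \<doteq> Z"
    have "?\<Gamma> \<turnstile> AllN (ExN ?Q) \<^bold>\<longrightarrow> choice_fun ?Q"
      using schemata(2) by (intro ded.Axiom) (auto simp: QF_AC00_def)
    moreover have "?\<Gamma> \<turnstile> AllN (ExN ?Q)"
    proof (rule ded.AllNI, rule total_unique_cases)
      show "map liftN ?\<Gamma> \<turnstile> total_unique A (\<lambda>n. NVar (Suc n)) ?\<tau>"
        by (rule ded.Assm) (simp add: H_def)
      let ?\<Delta> = "At A ?\<sigma> ?\<tau> v1 v0 # map liftN (map liftN ?\<Gamma>)"
      have "?\<Delta> \<turnstile> ?Q" by (rule ded.ImpE[OF ded_weaken_Cons[OF K1] ded.Assm]) simp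
      then have "?\<Delta> \<turnstile> ExN (App (FVar 0) (pair v2 v0) \<doteq> Z)"
        by (intro ded.ExNI[of _ _ v0]) (simp_all add: instN_def)
      then show "At A (lift\<sigma> (\<lambda>n. NVar (Suc n))) (lift\<tau> ?\<tau>) (liftT v0) v0 #
          map liftN (map liftN ?\<Gamma>) \<turnstile> liftN (ExN ?Q)" by simp
    qed simp_all
    ultimately have "?\<Gamma> \<turnstile> choice_fun ?Q" by (rule ded.ImpE)
    then show "?\<Gamma> \<turnstile> liftF (choice_fun A)" unfolding choice_fun_def[of ?Q]
    proof (rule ded.ExFE)
      let ?R = "AllN (sub_fm (case_nat (App (FVar 0) v0) NVar) (\<lambda>n. FVar (Suc n)) ?Q)"
      let ?\<Delta> = "?R # map liftF ?\<Gamma>"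
      \<comment> \<open>\<open>FVar 0\<close> is now the choice function and
        \<open>FVar (Suc 0)\<close> is \<beta>, so the function parameters of \<open>A\<close> are
        shifted by two.\<close>
      let ?\<tau>' = "\<lambda>n. FVar (Suc (Suc n))"
      have "?\<Delta> \<turnstile> AllN (AllN (App (FVar (Suc 0)) (pair v1 v0) \<doteq> Z \<^bold>\<longrightarrow> At A ?\<sigma> ?\<tau>' v1 v0))"
        using ded_liftF[OF K2] by (intro ded_weaken_Cons) simp
      \<comment> \<open>Taking the chosen value as second component makes the premise exactly what
        choice has provided.\<close>
      from ded.AllNE[OF ded_AllN_open[OF this], of "App (FVar 0) v0"]
      have "map liftN ?\<Delta> \<turnstile> App (FVar (Suc 0)) (pair v0 (App (FVar 0) v0)) \<doteq> Z \<^bold>\<longrightarrow>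
          At A (\<lambda>n. NVar (Suc n)) ?\<tau>' v0 (App (FVar 0) v0)"
        by (simp add: instN_def)
      moreover have "map liftN ?\<Delta> \<turnstile> App (FVar (Suc 0)) (pair v0 (App (FVar 0) v0)) \<doteq> Z"
        using ded_AllN_open[OF ded.Assm[of ?R ?\<Delta>]] by simp
      ultimately have "map liftN ?\<Delta> \<turnstile> At A (\<lambda>n. NVar (Suc n)) ?\<tau>' v0 (App (FVar 0) v0)"
        by (rule ded.ImpE)
      from ded.AllNI[OF this] show "?\<Delta> \<turnstile> liftF (liftF (choice_fun A))"
        unfolding choice_fun_At
        by (simp del: list.map) (rule ded.ExFI[of _ _ "FVar 0"], simp_all add: instF_def upN_fnc_def)
    qed
  qed
qed (simp add: ExN1_def)

end

section \<open>Replacement from lambda-conversion\<close>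

text \<open>The equality axioms of IA1 in isolation. Congruence is available only for application of
  a function variable; lambda-conversion is what extends it to all terms.\<close>

locale lambda_equality =
  fixes L :: "'c lang" and T :: "'c fm set"
  assumes refl_ax: "ded L T [] (v0 \<doteq> v0)"
    and euclid_ax: "ded L T [] (v0 \<doteq> v1 \<^bold>\<longrightarrow> v0 \<doteq> v2 \<^bold>\<longrightarrow> v1 \<doteq> v2)"
    and ext_ax: "ded L T [] (v0 \<doteq> v1 \<^bold>\<longrightarrow> App (FVar 0) v0 \<doteq> App (FVar 0) v1)"
    and beta_ax: "lambda_conversion L \<subseteq> T"
begin

lemma lambda_refl: "wf_trm L t \<Longrightarrow> ded L T \<Gamma> (t \<doteq> t)"
  using ded_inst[OF refl_ax, of "\<lambda>_. t"] by simp

lemma lambda_euclid: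
  assumes "ded L T \<Gamma> (r \<doteq> s)" "ded L T \<Gamma> (r \<doteq> t)" "wf_trm L r" "wf_trm L s" "wf_trm L t"
  shows "ded L T \<Gamma> (s \<doteq> t)"
proof -
  have "ded L T \<Gamma> (r \<doteq> s \<^bold>\<longrightarrow> r \<doteq> t \<^bold>\<longrightarrow> s \<doteq> t)"
    using ded_sub_closed[OF euclid_ax, of "case_nat r (case_nat s (\<lambda>_. t))" FVar] assms
    by (simp add: wf_sub_def split: nat.split)
  then show ?thesis using assms ded.ImpE by blast
qed

lemma lambda_sym: "ded L T \<Gamma> (s \<doteq> t) \<Longrightarrow> wf_trm L s \<Longrightarrow> wf_trm L t \<Longrightarrow> ded L T \<Gamma> (t \<doteq> s)"
  by (rule lambda_euclid[of _ s]) (simp_all add: lambda_refl)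

text \<open>A term \<open>r(s)\<close> is convertible to \<open>(\<lambda>x. r(x))(s)\<close>, and application respects equality.\<close>

lemma instT_cong:
  assumes "ded L T \<Gamma> (s \<doteq> t)" and [simp]: "wf_trm L r" "wf_trm L s" "wf_trm L t"
  shows "ded L T \<Gamma> (instT r s \<doteq> instT r t)"
proof -
  have wf [simp]: "wf_trm L (instT r x)" if "wf_trm L x" for x
    unfolding instT_def using that by (intro wf_sub_trm) (auto simp: wf_sub_def split: nat.split)
  have b: "ded L T \<Gamma> (App (Lam r) x \<doteq> instT r x)" if "wf_trm L x" for x
    using beta_ax that by (intro ded.Axiom) (auto simp: lambda_conversion_def)
  \<comment> \<open>The function variable of the axiom is specialised to \<open>Lam r\<close>, which
    turns an arbitrary term context into a functor.\<close>
  have "ded L T \<Gamma> (s \<doteq> t \<^bold>\<longrightarrow> App (Lam r) s \<doteq> App (Lam r) t)"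
    using ded_sub_closed[OF ext_ax, of "case_nat s (\<lambda>_. t)" "\<lambda>_. Lam r"]
    by (simp add: wf_sub_def split: nat.split)
  then have "ded L T \<Gamma> (App (Lam r) s \<doteq> App (Lam r) t)" using assms(1) by (rule ded.ImpE)
  from lambda_euclid[OF b this] have "ded L T \<Gamma> (instT r s \<doteq> App (Lam r) t)" by simp
  from lambda_euclid[OF lambda_sym[OF this] b] show ?thesis by simp
qed

lemma upN_trm_upd: "upN_trm (\<sigma>(i := s)) = (upN_trm \<sigma>)(Suc i := liftT s)"
  and upF_trm_upd: "upF_trm (\<sigma>(i := s)) = (upF_trm \<sigma>)(i := ren_trm id Suc s)"
  by (auto simp: fun_eq_iff upN_trm_def upF_trm_def split: nat.split)

lemma wf_sub_upd: "wf_sub L \<sigma> \<tau> \<Longrightarrow> wf_trm L s \<Longrightarrow> wf_sub L (\<sigma>(i := s)) \<tau>"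
  by (simp add: wf_sub_def)

text \<open>Replacement at index \<open>i\<close> reduces to \<open>instT_cong\<close>: all other
  values are lifted, and index 0 is freed to mark the place.\<close>

lemma sub_trm_cong_eq:
  assumes "ded L T \<Gamma> (s \<doteq> t)" "wf_trm L r" "wf_sub L \<sigma> \<tau>" "wf_trm L s" "wf_trm L t"
  shows "ded L T \<Gamma> (sub_trm (\<sigma>(i := s)) \<tau> r \<doteq> sub_trm (\<sigma>(i := t)) \<tau> r)"
proof -
  let ?\<sigma> = "(\<lambda>n. liftT (\<sigma> n))(i := v0)" and ?\<tau> = "\<lambda>n. ren_fnc Suc id (\<tau> n)"
  have "instT (sub_trm ?\<sigma> ?\<tau> r) x = sub_trm (\<sigma>(i := x)) \<tau> r" for x
    unfolding instT_def sub_sub_trm by (rule sub_trm_cong) auto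
  moreover have "wf_trm L (sub_trm ?\<sigma> ?\<tau> r)"
    using assms by (intro wf_sub_trm) (auto simp: wf_sub_def)
  ultimately show ?thesis using instT_cong[of \<Gamma> s t "sub_trm ?\<sigma> ?\<tau> r"] assms by simp
qed

lemma ded_ExN_lift: "ded L T \<Gamma> A \<Longrightarrow> wf_fm L A \<Longrightarrow> ded L T \<Gamma> (liftN (ExN A))"
  by (simp, rule ded.ExNI[of _ _ v0]) simp_all

lemma ded_ExF_lift: "ded L T \<Gamma> A \<Longrightarrow> wf_fm L A \<Longrightarrow> ded L T \<Gamma> (liftF (ExF A))"
  by (simp, rule ded.ExFI[of _ _ "FVar 0"]) simp_all

text \<open>The index \<open>i\<close> is arbitrary because a number binder moves the marked place
  up by one. The terms \<open>s\<close> and \<open>t\<close> are arbitrary because negation and the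
  premise of an implication call for the hypothesis with the equation reversed, and binders lift
  both terms.\<close>

lemma sub_fm_replace:
  \<comment> \<open>The updates must remain visible so that \<open>upN_trm_upd\<close> and
    \<open>upF_trm_upd\<close> can carry them under binders.\<close>
  notes fun_upd_apply [simp del]
  assumes "wf_fm L A" "wf_sub L \<sigma> \<tau>" "wf_trm L s" "wf_trm L t" "ded L T \<Gamma> (s \<doteq> t)"
    "ded L T \<Gamma> (sub_fm (\<sigma>(i := s)) \<tau> A)"
  shows "ded L T \<Gamma> (sub_fm (\<sigma>(i := t)) \<tau> A)"
  using assms
proof (induction A arbitrary: \<sigma> \<tau> s t \<Gamma> i)
  case (Eq p q)
  have "ded L T \<Gamma> (sub_trm (\<sigma>(i := s)) \<tau> r \<doteq> sub_trm (\<sigma>(i := t)) \<tau> r)" if "wf_trm L r" for r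
    using sub_trm_cong_eq that Eq.prems by blast
  note e = this[of p] this[of q]
  have wf: "wf_trm L (sub_trm (\<sigma>(i := x)) \<tau> r)" if "wf_trm L r" "wf_trm L x" for r x
    using that Eq.prems by (intro wf_sub_trm wf_sub_upd) auto
  have "ded L T \<Gamma> (sub_trm (\<sigma>(i := t)) \<tau> p \<doteq> sub_trm (\<sigma>(i := s)) \<tau> q)"
    using lambda_euclid[OF e(1)] Eq.prems wf by simp
  from lambda_euclid[OF lambda_sym[OF this] e(2)] show ?case using Eq.prems wf by simp
next
  case (Neg A)
  have [simp]: "wf_fm L (sub_fm (\<sigma>(i := x)) \<tau> A)" if "wf_trm L x" for x
    using that Neg.prems by (intro wf_sub_fm wf_sub_upd) auto
  let ?\<Delta> = "sub_fm (\<sigma>(i := t)) \<tau> A # \<Gamma>"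
  have "ded L T ?\<Delta> (sub_fm (\<sigma>(i := s)) \<tau> A)"
    using Neg.prems ded_weaken_Cons[OF lambda_sym[OF Neg.prems(5)]]
    by (intro Neg.IH[of \<sigma> \<tau> t s]) (simp_all add: ded.Assm)
  moreover have "ded L T ?\<Delta> (\<^bold>\<not> sub_fm (\<sigma>(i := s)) \<tau> A)"
    using Neg.prems(6) by (intro ded_weaken_Cons) simp
  ultimately show ?case using Neg.prems by (auto intro: ded.NegI)
next
  case (And A B)
  have "ded L T \<Gamma> (sub_fm (\<sigma>(i := t)) \<tau> A)"
    using And.prems by (intro And.IH(1)[of \<sigma> \<tau> s t]) (auto intro: ded.AndE1)
  moreover have "ded L T \<Gamma> (sub_fm (\<sigma>(i := t)) \<tau> B)"
    using And.prems by (intro And.IH(2)[of \<sigma> \<tau> s t]) (auto intro: ded.AndE2)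
  ultimately show ?case by (simp add: ded.AndI)
next
  case (Or A B)
  have [simp]: "wf_fm L (sub_fm (\<sigma>(i := t)) \<tau> A)" "wf_fm L (sub_fm (\<sigma>(i := t)) \<tau> B)"
    using Or.prems by (auto intro!: wf_sub_fm wf_sub_upd)
  have 1: "ded L T (sub_fm (\<sigma>(i := s)) \<tau> A # \<Gamma>) (sub_fm (\<sigma>(i := t)) \<tau> A)"
    using Or.prems by (intro Or.IH(1)[of \<sigma> \<tau> s t]) (auto intro: ded.Assm ded_weaken_Cons)
  have 2: "ded L T (sub_fm (\<sigma>(i := s)) \<tau> B # \<Gamma>) (sub_fm (\<sigma>(i := t)) \<tau> B)"
    using Or.prems by (intro Or.IH(2)[of \<sigma> \<tau> s t]) (auto intro: ded.Assm ded_weaken_Cons)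
  have "ded L T \<Gamma> (sub_fm (\<sigma>(i := s)) \<tau> A \<^bold>\<or> sub_fm (\<sigma>(i := s)) \<tau> B)"
    using Or.prems(6) by simp
  from ded.OrE[OF this ded.OrI1[OF 1] ded.OrI2[OF _ 2]] show ?case by simp
next
  case (Imp A B)
  have [simp]: "wf_fm L (sub_fm (\<sigma>(i := t)) \<tau> A)"
    using Imp.prems by (auto intro!: wf_sub_fm wf_sub_upd)
  let ?\<Delta> = "sub_fm (\<sigma>(i := t)) \<tau> A # \<Gamma>"
  have "ded L T ?\<Delta> (sub_fm (\<sigma>(i := s)) \<tau> A)"
    using Imp.prems ded_weaken_Cons[OF lambda_sym[OF Imp.prems(5)]]
    by (intro Imp.IH(1)[of \<sigma> \<tau> t s]) (simp_all add: ded.Assm)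
  moreover have "ded L T ?\<Delta> (sub_fm (\<sigma>(i := s)) \<tau> A \<^bold>\<longrightarrow> sub_fm (\<sigma>(i := s)) \<tau> B)"
    using Imp.prems(6) by (intro ded_weaken_Cons) simp
  ultimately have "ded L T ?\<Delta> (sub_fm (\<sigma>(i := s)) \<tau> B)" using ded.ImpE by blast
  then have "ded L T ?\<Delta> (sub_fm (\<sigma>(i := t)) \<tau> B)"
    using Imp.prems by (intro Imp.IH(2)[of \<sigma> \<tau> s t]) (auto intro: ded_weaken_Cons)
  then show ?case by (simp add: ded.ImpI)
next
  case (AllN A)
  have "ded L T \<Gamma> (AllN (sub_fm ((upN_trm \<sigma>)(Suc i := liftT s)) (upN_fnc \<tau>) A))"
    using AllN.prems(6) by (simp add: upN_trm_upd)
  from ded_AllN_open[OF this] have "ded L T (map liftN \<Gamma>) (sub_fm ((upN_trm \<sigma>)(Suc i := liftT t)) (upN_fnc \<tau>) A)"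
    using AllN.prems ded_liftN[OF AllN.prems(5)] by - (rule AllN.IH[of _ _ "liftT s"], simp_all)
  then show ?case by (simp add: upN_trm_upd ded.AllNI)
next
  case (AllF A)
  have "ded L T \<Gamma> (AllF (sub_fm ((upF_trm \<sigma>)(i := ren_trm id Suc s)) (upF_fnc \<tau>) A))"
    using AllF.prems(6) by (simp add: upF_trm_upd)
  from ded_AllF_open[OF this] have "ded L T (map liftF \<Gamma>) (sub_fm ((upF_trm \<sigma>)(i := ren_trm id Suc t)) (upF_fnc \<tau>) A)"
    using AllF.prems ded_liftF[OF AllF.prems(5)] by - (rule AllF.IH[of _ _ "ren_trm id Suc s"], simp_all)
  then show ?case by (simp add: upF_trm_upd ded.AllFI)
next
  case (ExN A)
  let ?A = "\<lambda>x. sub_fm ((upN_trm \<sigma>)(Suc i := liftT x)) (upN_fnc \<tau>) A"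
  have "ded L T (?A s # map liftN \<Gamma>) (?A t)"
    using ExN.prems ded_liftN[OF ExN.prems(5)]
    by - (rule ExN.IH[of _ _ "liftT s"], simp_all add: ded.Assm ded_weaken_Cons)
  \<comment> \<open>The witness of the old formula serves unchanged for the new one.\<close>
  then have "ded L T (?A s # map liftN \<Gamma>) (liftN (ExN (?A t)))"
    using ExN.prems by (intro ded_ExN_lift wf_sub_fm wf_sub_upd) simp_all
  moreover have "ded L T \<Gamma> (ExN (?A s))" using ExN.prems(6) by (simp add: upN_trm_upd)
  ultimately have "ded L T \<Gamma> (ExN (?A t))" by (rule ded.ExNE[rotated])
  then show ?case by (simp add: upN_trm_upd)
next
  case (ExF A)
  let ?A = "\<lambda>x. sub_fm ((upF_trm \<sigma>)(i := ren_trm id Suc x)) (upF_fnc \<tau>) A"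
  have "ded L T (?A s # map liftF \<Gamma>) (?A t)"
    using ExF.prems ded_liftF[OF ExF.prems(5)]
    by - (rule ExF.IH[of _ _ "ren_trm id Suc s"], simp_all add: ded.Assm ded_weaken_Cons)
  then have "ded L T (?A s # map liftF \<Gamma>) (liftF (ExF (?A t)))"
    using ExF.prems by (intro ded_ExF_lift wf_sub_fm wf_sub_upd) simp_all
  moreover have "ded L T \<Gamma> (ExF (?A s))" using ExF.prems(6) by (simp add: upF_trm_upd)
  ultimately have "ded L T \<Gamma> (ExF (?A t))" by (rule ded.ExFE[rotated])
  then show ?case by (simp add: upF_trm_upd)
qed

sublocale equality_logic L T
proof
  fix A s t \<Gamma>
  assume *: "wf_fm L A" "wf_trm L s" "wf_trm L t" "ded L T \<Gamma> (s \<doteq> t)" "ded L T \<Gamma> (instN A s)"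
  have "(case_nat s NVar)(0 := x) = case_nat x NVar" for x :: "'c trm"
    by (auto simp: fun_eq_iff split: nat.split)
  then show "ded L T \<Gamma> (instN A t)"
    using * sub_fm_replace[of A "case_nat s NVar" FVar s t \<Gamma> 0]
    by (auto simp: instN_def wf_sub_def split: nat.splits)
qed (rule refl_ax)

end

section \<open>The two systems\<close>

abbreviation "IA_theory d \<equiv> IA1 d \<union> QF_AC00 (IA_lang d) \<union> CF_d (IA_lang d)"
abbreviation "HA_theory \<equiv> HA1 \<union> QF_AC00 HA_lang \<union> CF_d HA_lang"

lemma IA_arithmetic_axiom: "A \<in> ia_arithmetic \<Longrightarrow> ded (IA_lang d) (IA_theory d) \<Gamma> A"
  by (rule ded.Axiom) (simp add: IA1_def)

lemma IA_defining_equation: "A \<in> ia_defining_equations \<Longrightarrow> ded (IA_lang d) (IA_theory d) \<Gamma> A"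
  by (rule ded.Axiom) (simp add: IA1_def)

interpretation IA: lambda_equality "IA_lang d" "IA_theory d" for d
proof
  show "lambda_conversion (IA_lang d) \<subseteq> IA_theory d" unfolding IA1_def by blast
qed (rule IA_arithmetic_axiom; simp add: ia_arithmetic_def Let_def numeral_2_eq_2)+

lemma IA_lang_simps [simp]:
  "arity (IA_lang d) c = Some (if c = ICcp then defn_arity d else ia_arity c)"
  "zeroC (IA_lang d) = IZero" "sucC (IA_lang d) = ISuc" "plusC (IA_lang d) = IAdd"
  by (simp_all add: IA_lang_def)

text \<open>The sum of \<open>y + 1\<close> over all \<open>y < s\<close>, which is the triangular
  number 0 + ... + s.\<close>

abbreviation iTri :: "ia_trm \<Rightarrow> ia_trm" where "iTri s \<equiv> iSum s (Lam (iS v0))"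

lemma IA_iTri_suc: "ded (IA_lang d) (IA_theory d) [] (iTri (iS v0) \<doteq> iS (iTri v0 \<^bold>+ v0))"
proof -
  let ?D = "ded (IA_lang d) (IA_theory d) []"
  have "?D (iSum (iS v0) (FVar 0) \<doteq> iSum v0 (FVar 0) \<^bold>+ App (FVar 0) v0)"
    by (rule IA_defining_equation) (simp add: ia_defining_equations_def Let_def)
  \<comment> \<open>The recursion equation is stated for a function variable, which is replaced here
    by the summand of \<open>iTri\<close>.\<close>
  from ded_sub_closed[OF this, of NVar "\<lambda>_. Lam (iS v0)"]
  have 1: "?D (iTri (iS v0) \<doteq> iTri v0 \<^bold>+ App (Lam (iS v0)) v0)" by (simp add: wf_sub_def)
  have "?D (App (Lam (iS v0)) v0 \<doteq> instT (iS v0) v0)"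
    by (rule ded.Axiom) (force simp: IA1_def lambda_conversion_def)
  \<comment> \<open>\<open>v0\<close> marks the place of replacement; \<open>v1\<close> drops to
    \<open>v0\<close> when that place is instantiated.\<close>
  from IA.eq_cong[OF this, of "iTri v1 \<^bold>+ v0"]
  have 2: "?D (iTri v0 \<^bold>+ App (Lam (iS v0)) v0 \<doteq> iTri v0 \<^bold>+ iS v0)" by (simp add: instT_def)
  have "?D (v0 \<^bold>+ iS v1 \<doteq> iS (v0 \<^bold>+ v1))"
    by (rule IA_defining_equation) (simp add: ia_defining_equations_def Let_def)
  from ded_inst2[OF this, of "iTri v0" v0] have 3: "?D (iTri v0 \<^bold>+ iS v0 \<doteq> iS (iTri v0 \<^bold>+ v0))"
    by simp
  show ?thesis by (rule IA.eq_trans[OF 1 IA.eq_trans[OF 2 3]]) simp_all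
qed

interpretation IA: choice_arithmetic "IA_lang d" "IA_theory d" "\<lambda>s t. s \<^bold>+ t" iTri for d
proof
  show "ded (IA_lang d) (IA_theory d) [] (iTri (Zero (IA_lang d)) \<doteq> Zero (IA_lang d))"
  proof -
    have "ded (IA_lang d) (IA_theory d) [] (iSum \<^bold>0 (FVar 0) \<doteq> \<^bold>0)"
      by (rule IA_defining_equation) (simp add: ia_defining_equations_def Let_def)
    from ded_sub_closed[OF this, of NVar "\<lambda>_. Lam (iS v0)"] show ?thesis
      by (simp add: wf_sub_def Zero_def)
  qed
  show "ded (IA_lang d) (IA_theory d) []
      (iTri (Succ (IA_lang d) v0) \<doteq> Succ (IA_lang d) (iTri v0 \<^bold>+ v0))"
    using IA_iTri_suc by (simp add: Succ_def)
qed (auto intro!: ded.Axiom simp: IA1_def ia_arithmetic_def ia_defining_equations_def Let_def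
       Zero_def Succ_def wf_sub_def upN_trm_def)

section \<open>Equality and arithmetic in HA1 from primitive recursive descriptions\<close>

lemma HA_lang_simps [simp]:
  "arity HA_lang HZero = Some (0, 0)"
  "arity HA_lang (HPR f) = (if wf_pr f then Some (pr_arity f, 0) else None)"
  "zeroC HA_lang = HZero" "sucC HA_lang = HPR PSuc" "plusC HA_lang = HPR pr_add"
  by (simp_all add: HA_lang_def)

text \<open>The schema of HA1 replaces one variable by another. It is applied to two fresh
  variables, for which the terms are then substituted.\<close>

interpretation HA: equality_logic HA_lang HA_theory
proof
  show "ded HA_lang HA_theory [] (v0 \<doteq> v0)" by (rule ded.Axiom) (simp add: HA1_def)
  fix A s t \<Gamma>
  assume *: "wf_fm HA_lang A" "wf_trm HA_lang s" "wf_trm HA_lang t" "ded HA_lang HA_theory \<Gamma> (s \<doteq> t)"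
    "ded HA_lang HA_theory \<Gamma> (instN A s)"
  \<comment> \<open>Index 0 is the place of replacement. The parameters start at 3, so that after
    its instantiation they start at 2 and leave \<open>v0\<close> and \<open>v1\<close> free for the
    two sides of the equation.\<close>
  define A' where "A' = sub_fm (case_nat v0 (\<lambda>n. NVar (Suc (Suc (Suc n))))) FVar A"
  have "wf_fm HA_lang A'" unfolding A'_def
    using *(1) by (rule wf_sub_fm) (auto simp: wf_sub_def split: nat.split)
  then have "instN A' v0 \<^bold>\<and> v0 \<doteq> v1 \<^bold>\<longrightarrow> instN A' v1 \<in> HA1"
    unfolding HA1_def replacement_schema_def by blast
  then have "ded HA_lang HA_theory [] (instN A' v0 \<^bold>\<and> v0 \<doteq> v1 \<^bold>\<longrightarrow> instN A' v1)"
    by (intro ded.Axiom) simp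
  from ded_sub_closed[OF this, of "case_nat s (case_nat t NVar)" FVar]
  have "ded HA_lang HA_theory \<Gamma> (sub_fm (case_nat s (case_nat t NVar)) FVar (instN A' v0) \<^bold>\<and> s \<doteq> t \<^bold>\<longrightarrow>
      sub_fm (case_nat s (case_nat t NVar)) FVar (instN A' v1))"
    using * by (simp add: wf_sub_def split: nat.split)
  moreover have "sub_fm (case_nat s (case_nat t NVar)) FVar (instN A' (NVar i)) =
      instN A (case_nat s (case_nat t NVar) i)" for i
    unfolding A'_def instN_def sub_sub_fm by (rule sub_fm_cong) (auto split: nat.split)
  ultimately have "ded HA_lang HA_theory \<Gamma> (instN A s \<^bold>\<and> s \<doteq> t \<^bold>\<longrightarrow> instN A t)" by simp
  then show "ded HA_lang HA_theory \<Gamma> (instN A t)" using ded.AndI[OF *(5,4)] by (rule ded.ImpE)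
qed

lemma sub_hF [simp]: "sub_trm \<sigma> \<tau> (hF f ts) = hF f (map (sub_trm \<sigma> \<tau>) ts)"
  by (cases ts) (auto simp: capp_def)

lemma wf_hF [simp]:
  "wf_trm HA_lang (hF f ts) \<longleftrightarrow> wf_pr f \<and> pr_arity f = length ts \<and> (\<forall>t \<in> set ts. wf_trm HA_lang t)"
  by (cases ts) (auto simp: capp_def)

context
  fixes ts :: "ha_trm list" and n :: nat
  assumes ts: "length ts = n" "\<forall>t \<in> set ts. wf_trm HA_lang t"
begin

text \<open>Values for the variables of a defining equation: indices below \<open>n\<close> are the
  arguments, and \<open>NVar n\<close> is the recursion variable of \<open>PRec\<close>, which
  receives \<open>t\<close>. Equations without recursion use \<open>hZ\<close> as a filler.\<close>

definition args :: "ha_trm \<Rightarrow> nat \<Rightarrow> ha_trm" where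
  "args t i = (if i < n then ts ! i else t)"

lemma map_args: "map (args t) [0..<n] = ts"
  by (rule nth_equalityI) (simp_all add: args_def ts)

lemma sub_comp_NVar [simp]: "sub_trm \<sigma> \<tau> \<circ> NVar = \<sigma>"
  by (simp add: fun_eq_iff)

lemma args_simps: "args t n = t" "i < n \<Longrightarrow> args t i = ts ! i"
  by (simp_all add: args_def)

lemma pr_equation_inst:
  assumes "wf_pr f" "A \<in> pr_equations f" "wf_trm HA_lang t"
  shows "ded HA_lang HA_theory \<Gamma> (sub_fm (args t) FVar A)"
  using assms ts by (intro ded_sub_closed ded.Axiom) (auto simp: HA1_def wf_sub_def args_def)

lemma HA_PZero: "ded HA_lang HA_theory \<Gamma> (hF (PZero n) ts \<doteq> hZ)"
  using pr_equation_inst[of "PZero n" "hF (PZero n) (nvars n) \<doteq> hZ" hZ \<Gamma>] by (simp add: map_args)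

lemma HA_PProj: "i < n \<Longrightarrow> ded HA_lang HA_theory \<Gamma> (hF (PProj n i) ts \<doteq> ts ! i)"
  using pr_equation_inst[of "PProj n i" "hF (PProj n i) (nvars n) \<doteq> NVar i" hZ \<Gamma>]
  by (simp add: map_args args_simps)

lemma HA_PComp:
  assumes "wf_pr (PComp n f gs)"
  shows "ded HA_lang HA_theory \<Gamma> (hF (PComp n f gs) ts \<doteq> hF f (map (\<lambda>g. hF g ts) gs))"
  using pr_equation_inst[OF assms, of "hF (PComp n f gs) (nvars n) \<doteq>
    hF f (map (\<lambda>g. hF g (nvars n)) gs)" hZ \<Gamma>]
  by (simp add: map_args comp_def[of _ "\<lambda>g. hF g (nvars n)"])

lemma
  assumes "wf_pr (PRec n g h)"
  shows HA_PRec_zero: "ded HA_lang HA_theory \<Gamma> (hF (PRec n g h) (hZ # ts) \<doteq> hF g ts)"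
    and HA_PRec_suc: "wf_trm HA_lang t \<Longrightarrow> ded HA_lang HA_theory \<Gamma>
      (hF (PRec n g h) (hS t # ts) \<doteq> hF h (t # hF (PRec n g h) (t # ts) # ts))"
  using pr_equation_inst[OF assms, of "hF (PRec n g h) (hZ # nvars n) \<doteq> hF g (nvars n)" hZ \<Gamma>]
    pr_equation_inst[OF assms, of "hF (PRec n g h) (hS (NVar n) # nvars n) \<doteq>
        hF h (NVar n # hF (PRec n g h) (NVar n # nvars n) # nvars n)" t \<Gamma>]
  by (simp_all add: map_args args_simps)

end

text \<open>Predecessor and sign supply the successor facts which HA1 does not postulate. In
  \<open>pr_tri\<close>, \<open>pr_add\<close> fits without projections because the step function
  receives just the pair of recursion variable and previous value.\<close>

definition pr_pred :: pr where "pr_pred = PRec 0 (PZero 0) (PProj 2 0)"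
definition pr_sg :: pr where "pr_sg = PRec 0 (PZero 0) (PComp 2 PSuc [PZero 2])"
definition pr_tri :: pr where "pr_tri = PRec 0 (PZero 0) (PComp 2 PSuc [pr_add])"

text \<open>\<open>pr_add\<close> recurses on its first argument, while the interface expects
  recursion on the right summand; hence the swap.\<close>

abbreviation hAdd :: "ha_trm \<Rightarrow> ha_trm \<Rightarrow> ha_trm" where "hAdd s t \<equiv> Con (HPR pr_add) [t, s] []"
abbreviation hTri :: "ha_trm \<Rightarrow> ha_trm" where "hTri t \<equiv> App (FCon (HPR pr_tri)) t"

lemma wf_pr_defs [simp]:
  "wf_pr pr_add" "pr_arity pr_add = 2" "wf_pr pr_pred" "pr_arity pr_pred = 1"
  "wf_pr pr_sg" "pr_arity pr_sg = 1" "wf_pr pr_tri" "pr_arity pr_tri = 1"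
  by (simp_all add: pr_add_def pr_pred_def pr_sg_def pr_tri_def)

lemma hF_simps:
  "hF f [t] = App (FCon (HPR f)) t" "hF f [] = Con (HPR f) [] []"
  "hF f [s, t] = Con (HPR f) [s, t] []" "hF f [r, s, t] = Con (HPR f) [r, s, t] []"
  by (simp_all add: capp_def)

lemma HA_suc_cong: "ded HA_lang HA_theory \<Gamma> (s \<doteq> t) \<Longrightarrow> wf_trm HA_lang s \<Longrightarrow> wf_trm HA_lang t \<Longrightarrow>
    ded HA_lang HA_theory \<Gamma> (hS s \<doteq> hS t)"
  using HA.eq_cong[of \<Gamma> s t "hS v0"] by (simp add: instT_def)

lemma HA_add_zero: "ded HA_lang HA_theory \<Gamma> (hAdd v0 hZ \<doteq> v0)"
proof -
  have "ded HA_lang HA_theory \<Gamma> (hF pr_add [hZ, v0] \<doteq> hF (PProj 1 0) [v0])"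
    unfolding pr_add_def by (rule HA_PRec_zero) simp_all
  moreover have "ded HA_lang HA_theory \<Gamma> (hF (PProj 1 0) [v0] \<doteq> v0)"
    using HA_PProj[of "[v0]" 1 0] by simp
  ultimately have "ded HA_lang HA_theory \<Gamma> (hF pr_add [hZ, v0] \<doteq> v0)"
    by (rule HA.eq_trans) simp_all
  then show ?thesis by (simp add: hF_simps)
qed

lemma HA_add_suc: "ded HA_lang HA_theory \<Gamma> (hAdd v0 (hS v1) \<doteq> hS (hAdd v0 v1))"
proof -
  let ?ts = "[v1, hF pr_add [v1, v0], v0]"
  have 1: "ded HA_lang HA_theory \<Gamma> (hF pr_add [hS v1, v0] \<doteq> hF (PComp 3 PSuc [PProj 3 1]) ?ts)"
    unfolding pr_add_def by (rule HA_PRec_suc) simp_all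
  have 2: "ded HA_lang HA_theory \<Gamma> (hF (PComp 3 PSuc [PProj 3 1]) ?ts \<doteq> hS (hF (PProj 3 1) ?ts))"
    using HA_PComp[of ?ts 3 PSuc "[PProj 3 1]"] by (simp add: hF_simps(1))
  have 3: "ded HA_lang HA_theory \<Gamma> (hS (hF (PProj 3 1) ?ts) \<doteq> hS (hF pr_add [v1, v0]))"
    using HA_PProj[of ?ts 3 1] by (intro HA_suc_cong) simp_all
  have "ded HA_lang HA_theory \<Gamma> (hF pr_add [hS v1, v0] \<doteq> hS (hF pr_add [v1, v0]))"
    by (rule HA.eq_trans[OF 1 HA.eq_trans[OF 2 3]]) simp_all
  then show ?thesis by (simp add: hF_simps)
qed

lemma HA_tri_zero: "ded HA_lang HA_theory \<Gamma> (hTri hZ \<doteq> hZ)"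
proof -
  have "ded HA_lang HA_theory \<Gamma> (hF pr_tri [hZ] \<doteq> hF (PZero 0) [])"
    unfolding pr_tri_def by (rule HA_PRec_zero) simp_all
  from HA.eq_trans[OF this HA_PZero] show ?thesis by (simp add: hF_simps)
qed

lemma HA_tri_suc: "ded HA_lang HA_theory \<Gamma> (hTri (hS v0) \<doteq> hS (hAdd (hTri v0) v0))"
proof -
  let ?ts = "[v0, hF pr_tri [v0]]"
  have "ded HA_lang HA_theory \<Gamma> (hF pr_tri [hS v0] \<doteq> hF (PComp 2 PSuc [pr_add]) ?ts)"
    unfolding pr_tri_def by (rule HA_PRec_suc) simp_all
  moreover have "ded HA_lang HA_theory \<Gamma> (hF (PComp 2 PSuc [pr_add]) ?ts \<doteq> hS (hF pr_add ?ts))"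
    using HA_PComp[of ?ts 2 PSuc "[pr_add]"] by (simp add: hF_simps(1))
  ultimately have "ded HA_lang HA_theory \<Gamma> (hF pr_tri [hS v0] \<doteq> hS (hF pr_add ?ts))"
    by (rule HA.eq_trans) simp_all
  then show ?thesis by (simp add: hF_simps)
qed

text \<open>Applying the sign function to both sides reduces the claim to the single axiom that 1 is
  not 0.\<close>

lemma HA_suc_neq: "ded HA_lang HA_theory [] (\<^bold>\<not> (hS v0 \<doteq> hZ))"
proof (rule ded.NegI)
  let ?\<Gamma> = "[hS v0 \<doteq> hZ]"
  have "ded HA_lang HA_theory ?\<Gamma> (hF pr_sg [hZ] \<doteq> hF (PZero 0) [])"
    unfolding pr_sg_def by (rule HA_PRec_zero) simp_all
  from HA.eq_trans[OF this HA_PZero] have zero: "ded HA_lang HA_theory ?\<Gamma> (hF pr_sg [hZ] \<doteq> hZ)"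
    by simp
  let ?ts = "[v0, hF pr_sg [v0]]"
  have 1: "ded HA_lang HA_theory ?\<Gamma> (hF pr_sg [hS v0] \<doteq> hF (PComp 2 PSuc [PZero 2]) ?ts)"
    unfolding pr_sg_def by (rule HA_PRec_suc) simp_all
  have 2: "ded HA_lang HA_theory ?\<Gamma> (hF (PComp 2 PSuc [PZero 2]) ?ts \<doteq> hS (hF (PZero 2) ?ts))"
    using HA_PComp[of ?ts 2 PSuc "[PZero 2]"] by (simp add: hF_simps(1))
  have 3: "ded HA_lang HA_theory ?\<Gamma> (hS (hF (PZero 2) ?ts) \<doteq> hS hZ)"
    by (rule HA_suc_cong[OF HA_PZero]) simp_all
  have suc: "ded HA_lang HA_theory ?\<Gamma> (hF pr_sg [hS v0] \<doteq> hS hZ)"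
    by (rule HA.eq_trans[OF 1 HA.eq_trans[OF 2 3]]) simp_all
  have "ded HA_lang HA_theory ?\<Gamma> (hF pr_sg [hS v0] \<doteq> hF pr_sg [hZ])"
    using HA.eq_cong[of ?\<Gamma> "hS v0" hZ "hF pr_sg [v0]"] by (simp add: instT_def ded.Assm)
  from HA.eq_trans[OF HA.eq_sym[OF suc] HA.eq_trans[OF this zero]]
  show "ded HA_lang HA_theory ?\<Gamma> (hS hZ \<doteq> hZ)" by simp
  show "ded HA_lang HA_theory ?\<Gamma> (\<^bold>\<not> (hS hZ \<doteq> hZ))"
    by (rule ded.Axiom) (simp add: HA1_def)
qed simp

text \<open>Applying the predecessor to both sides removes the successors.\<close>

lemma HA_suc_inj: "ded HA_lang HA_theory [] (hS v0 \<doteq> hS v1 \<^bold>\<longrightarrow> v0 \<doteq> v1)"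
proof (rule ded.ImpI)
  let ?\<Gamma> = "[hS v0 \<doteq> hS v1]"
  have p: "ded HA_lang HA_theory ?\<Gamma> (hF pr_pred [hS t] \<doteq> t)" if [simp]: "wf_trm HA_lang t" for t
  proof -
    let ?ts = "[t, hF pr_pred [t]]"
    have "ded HA_lang HA_theory ?\<Gamma> (hF pr_pred [hS t] \<doteq> hF (PProj 2 0) ?ts)"
      unfolding pr_pred_def by (rule HA_PRec_suc) simp_all
    moreover have "ded HA_lang HA_theory ?\<Gamma> (hF (PProj 2 0) ?ts \<doteq> t)"
      using HA_PProj[of ?ts 2 0] by simp
    ultimately show ?thesis by (rule HA.eq_trans) simp_all
  qed
  have "ded HA_lang HA_theory ?\<Gamma> (hF pr_pred [hS v0] \<doteq> hF pr_pred [hS v1])"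
    using HA.eq_cong[of ?\<Gamma> "hS v0" "hS v1" "hF pr_pred [v0]"] by (simp add: instT_def ded.Assm)
  from HA.eq_trans[OF HA.eq_sym[OF p] HA.eq_trans[OF this p]]
  show "ded HA_lang HA_theory ?\<Gamma> (v0 \<doteq> v1)" by simp
qed simp

interpretation HA: choice_arithmetic HA_lang HA_theory hAdd hTri
proof
  note defs = Zero_def Succ_def
  show "ded HA_lang HA_theory [] (\<^bold>\<not> (Succ HA_lang v0 \<doteq> Zero HA_lang))"
    using HA_suc_neq by (simp add: defs)
  show "ded HA_lang HA_theory [] (Succ HA_lang v0 \<doteq> Succ HA_lang v1 \<^bold>\<longrightarrow> v0 \<doteq> v1)"
    using HA_suc_inj by (simp add: defs)
  show "ded HA_lang HA_theory [] (hAdd v0 (Zero HA_lang) \<doteq> v0)"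
    using HA_add_zero by (simp add: defs)
  show "ded HA_lang HA_theory [] (hAdd v0 (Succ HA_lang v1) \<doteq> Succ HA_lang (hAdd v0 v1))"
    using HA_add_suc by (simp add: defs)
  show "ded HA_lang HA_theory [] (hTri (Zero HA_lang) \<doteq> Zero HA_lang)"
    using HA_tri_zero by (simp add: defs)
  show "ded HA_lang HA_theory [] (hTri (Succ HA_lang v0) \<doteq> Succ HA_lang (hAdd (hTri v0) v0))"
    using HA_tri_suc by (simp add: defs)
qed (auto simp: HA1_def)

theorem theorem3p2:
  shows "(\<forall>ccp. wf_defn ccp \<longrightarrow>
            (\<forall>F \<in> AC00_unique (IA_lang ccp).
               provable (IA_lang ccp)
                 (IA1 ccp \<union> QF_AC00 (IA_lang ccp) \<union> CF_d (IA_lang ccp)) F)) \<and>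
         (\<forall>F \<in> AC00_unique HA_lang.
            provable HA_lang (HA1 \<union> QF_AC00 HA_lang \<union> CF_d HA_lang) F)"
  unfolding AC00_unique_def provable_def
  using IA.unique_choice HA.unique_choice by blast

end
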